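(* For every integer $k\ge 2$, we have $|\mathcal{RSS}_k(1)|=k$, and for all integers $n\ge 2$, \[ |\mathcal{RSS}_k(n)|=\frac{1}{n+1}\binom{2n}{n}k^n-\frac{2n^3+9n^2-35n+30}{n^3+3n^2+2n}\binom{2n-2}{n-1}k^{n-1}+O_n(k^{n-2}). \] That is, for each $n\ge 2$ there is a constant $K_n>0$ depending only on $n$ such that for all $k\ge 2$ the difference between $|\mathcal{RSS}_k(n)|$ and the sum of the first two terms on the right-hand side is at most $K_n k^{n-2}$ in absolute value.
   Context: A word of length $\ell$ over an alphabet of size $k$ is an element of $[k]^\ell$, where $[k]=\{0,1,\dots,k-1\}$. A word $s=s_1s_2\cdots s_{2n}\in[k]^{2n}$ is a reverse shuffle square if there exist disjoint index sets $I=\{i_1<\cdots<i_n\}$ and $J=\{j_1<\cdots<j_n\}$ contained in $\{1,\dots,2n\}$ (so that they partition $\{1,\dots,2n\}$) with $s_{i_r}=s_{j_{n+1-r}}$ for all $1\le r\le n$. $\mathcal{RSS}_k(n)$ denotes the set of all reverse shuffle squares in $[k]^{2n}$. *)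

theory Defs
  imports Complex_Main
begin

definition words :: "nat \<Rightarrow> nat \<Rightarrow> nat list set" where
  "words k l = {s. length s = l \<and> set s \<subseteq> {0..<k}}"

text \<open>
  Positions in a list start at 0, so the letter at position \<open>p\<close> of the word
  (\<open>1 \<le> p \<le> 2 * n\<close>) is \<open>s ! (p - 1)\<close>. The functions \<open>i\<close> and \<open>j\<close> are the increasing
  enumerations of the two index sets \<open>I = i ` {1..n}\<close> and \<open>J = j ` {1..n}\<close>.
\<close>
definition reverse_shuffle_square :: "nat \<Rightarrow> nat list \<Rightarrow> bool" where
  "reverse_shuffle_square n s \<longleftrightarrow>
     length s = 2 * n \<and>
     (\<exists>i j :: nat \<Rightarrow> nat.
        strict_mono_on {1..n} i \<and> strict_mono_on {1..n} j \<and>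
        i ` {1..n} \<subseteq> {1..2 * n} \<and> j ` {1..n} \<subseteq> {1..2 * n} \<and>
        i ` {1..n} \<inter> j ` {1..n} = {} \<and>
        (\<forall>r\<in>{1..n}. s ! (i r - 1) = s ! (j (n + 1 - r) - 1)))"

definition RSS :: "nat \<Rightarrow> nat \<Rightarrow> nat list set" where
  "RSS k n = {s \<in> words k (2 * n). reverse_shuffle_square n s}"

end

theory Submission
  imports Defs "HOL-Combinatorics.Transposition"
begin

text \<open>
  In a reverse shuffle square every matched pair joins the first half to the second half, and the
  matching, read as a permutation, is a union of two decreasing sequences. So the words are exactly
  \<open>u @ map ((!) u) p\<close> with \<open>u\<close> arbitrary and \<open>p\<close> avoiding 123. If \<open>u\<close> has at least \<open>n - 1\<close>
  distinct letters, then \<open>u @ map ((!) u) p\<close> determines \<open>p\<close> up to the transposition of the two equal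
  letters; the other \<open>u\<close> contribute \<open>O(k ^ (n - 2))\<close>. Hence the leading coefficient counts the
  123-avoiding permutations (Catalan numbers), and the second one counts the pairs of 123-avoiding
  permutations that differ by a transposition. For such pairs \<open>a < b\<close>, with \<open>a\<close> before \<open>b\<close>, the
  transposed permutation avoids 123 iff (\<open>a\<close> is least among the entries before \<open>b\<close>, or all entries
  after \<open>b\<close> are below \<open>a\<close>) and (all entries before \<open>a\<close> are above \<open>b\<close>, or \<open>b\<close> is greatest among the
  entries after \<open>a\<close>). The two alternatives of the last factor are exchanged by a symmetry, so it
  suffices to count the pairs satisfying the first of them and those satisfying both. This is done
  along the generating tree that inserts the largest entry, whose states are the lengths of the
  initial decreasing run and whose path counts are ballot numbers.
\<close>

subsection \<open>The order of occurrence in a list\<close>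

text \<open>The order of occurrence is taken as a relation on entries instead of indices: on
  distinct lists it is a strict linear order, and inserting or transposing entries changes it by
  simple formulas.\<close>

fun before :: "'a list \<Rightarrow> ('a \<times> 'a) set" where
  "before [] = {}"
| "before (x # xs) = {x} \<times> set xs \<union> before xs"

lemma before_append: "before (xs @ ys) = before xs \<union> before ys \<union> set xs \<times> set ys"
  by (induction xs) auto

lemma before_insert:
  "before (ys @ x # zs) = before (ys @ zs) \<union> set ys \<times> {x} \<union> {x} \<times> set zs"
  by (auto simp: before_append)

lemma before_set: "(x, y) \<in> before xs \<Longrightarrow> x \<in> set xs \<and> y \<in> set xs"
  by (induction xs) auto

lemma before_map: "before (map f xs) = map_prod f f ` before xs"
  by (induction xs) auto

lemma before_trans: "distinct xs \<Longrightarrow> (x, y) \<in> before xs \<Longrightarrow> (y, z) \<in> before xs \<Longrightarrow> (x, z) \<in> before xs"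
  by (induction xs) (auto dest: before_set)

lemma before_irrefl: "distinct xs \<Longrightarrow> (x, x) \<notin> before xs"
  by (induction xs) (auto dest: before_set)

lemma before_asym: "distinct xs \<Longrightarrow> (x, y) \<in> before xs \<Longrightarrow> (y, x) \<notin> before xs"
  using before_trans[of xs x y x] before_irrefl[of xs x] by blast

lemma before_total: "x \<in> set xs \<Longrightarrow> y \<in> set xs \<Longrightarrow> x = y \<or> (x, y) \<in> before xs \<or> (y, x) \<in> before xs"
  by (induction xs) auto

lemma before_iff_nth: "(x, y) \<in> before xs \<longleftrightarrow> (\<exists>i j. i < j \<and> j < length xs \<and> xs ! i = x \<and> xs ! j = y)"
proof (induction xs)
  case (Cons z xs)
  have "(\<exists>i j. i < j \<and> j < length (z # xs) \<and> (z # xs) ! i = x \<and> (z # xs) ! j = y) \<longleftrightarrow>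
     (z = x \<and> (\<exists>j<length xs. xs ! j = y)) \<or>
     (\<exists>i j. i < j \<and> j < length xs \<and> xs ! i = x \<and> xs ! j = y)" (is "?l \<longleftrightarrow> ?r")
  proof
    assume ?l
    then obtain i j where "i < j" "j < length (z # xs)" "(z # xs) ! i = x" "(z # xs) ! j = y" by blast
    then show ?r by (cases i; cases j) auto
  next
    assume ?r
    then show ?l
    proof
      assume "z = x \<and> (\<exists>j<length xs. xs ! j = y)"
      then obtain j where "z = x" "j < length xs" "xs ! j = y" by blast
      then show ?l by (intro exI[of _ 0] exI[of _ "Suc j"]) auto
    next
      assume "\<exists>i j. i < j \<and> j < length xs \<and> xs ! i = x \<and> xs ! j = y"
      then obtain i j where "i < j" "j < length xs" "xs ! i = x" "xs ! j = y" by blast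
      then show ?l by (intro exI[of _ "Suc i"] exI[of _ "Suc j"]) auto
    qed
  qed
  then show ?case using Cons by (auto simp: in_set_conv_nth)
qed auto

lemma before_nth_iff:
  assumes "distinct xs" "i < length xs" "j < length xs"
  shows "(xs ! i, xs ! j) \<in> before xs \<longleftrightarrow> i < j"
  using assms by (auto simp: before_iff_nth nth_eq_iff_index_eq)

definition avoids123 :: "nat list \<Rightarrow> bool" where
  "avoids123 xs \<longleftrightarrow> (\<forall>x y z. (x, y) \<in> before xs \<longrightarrow> (y, z) \<in> before xs \<longrightarrow> x < y \<longrightarrow> \<not> y < z)"

definition Av :: "nat \<Rightarrow> nat list set" where
  "Av n = {xs. distinct xs \<and> set xs = {..<n} \<and> avoids123 xs}"

lemma Av_length: "xs \<in> Av n \<Longrightarrow> length xs = n"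
  unfolding Av_def using distinct_card by fastforce

lemma finite_Av: "finite (Av n)"
proof (rule finite_subset)
  show "Av n \<subseteq> {xs. set xs \<subseteq> {..<n} \<and> length xs = n}"
    using Av_length by (auto simp: Av_def)
qed (simp add: finite_lists_length_eq)

lemma Av_0: "Av 0 = {[]}"
  by (auto simp: Av_def avoids123_def)

lemma before_map_transpose:
  "(x, y) \<in> before (map (transpose a b) xs) \<longleftrightarrow> (transpose a b x, transpose a b y) \<in> before xs"
proof
  assume "(x, y) \<in> before (map (transpose a b) xs)"
  then show "(transpose a b x, transpose a b y) \<in> before xs" by (auto simp: before_map)
next
  assume "(transpose a b x, transpose a b y) \<in> before xs"
  then have "map_prod (transpose a b) (transpose a b) (transpose a b x, transpose a b y)
      \<in> before (map (transpose a b) xs)"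
    unfolding before_map by (rule imageI)
  then show "(x, y) \<in> before (map (transpose a b) xs)" by simp
qed

subsection \<open>Transpositions preserving avoidance\<close>

definition least_before :: "nat list \<Rightarrow> nat \<Rightarrow> nat \<Rightarrow> bool" where
  "least_before xs a b \<longleftrightarrow> (\<forall>r. (r, b) \<in> before xs \<longrightarrow> a \<le> r)"
definition below_after :: "nat list \<Rightarrow> nat \<Rightarrow> nat \<Rightarrow> bool" where
  "below_after xs a b \<longleftrightarrow> (\<forall>r. (b, r) \<in> before xs \<longrightarrow> r < a)"
definition above_before :: "nat list \<Rightarrow> nat \<Rightarrow> nat \<Rightarrow> bool" where
  "above_before xs a b \<longleftrightarrow> (\<forall>r. (r, a) \<in> before xs \<longrightarrow> b < r)"
definition greatest_after :: "nat list \<Rightarrow> nat \<Rightarrow> nat \<Rightarrow> bool" where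
  "greatest_after xs a b \<longleftrightarrow> (\<forall>r. (a, r) \<in> before xs \<longrightarrow> r \<le> b)"

definition swaps :: "nat list \<Rightarrow> (nat \<times> nat) set" where
  "swaps xs = {(a, b). a < b \<and> (a, b) \<in> before xs \<and> avoids123 (map (transpose a b) xs)}"

text \<open>After the transposition \<open>a\<close> sits at the old place of \<open>b\<close> and
  \<open>b\<close> at that of \<open>a\<close>. An increasing triple with middle \<open>a\<close>
  exists exactly if the first factor fails, one with middle \<open>b\<close> exactly if the second
  fails. Any other triple yields one in \<open>xs\<close>: since \<open>a\<close> is earlier and
  smaller than \<open>b\<close>, an outer entry from the pair can be read as \<open>a\<close> at the
  low end and as \<open>b\<close> at the high end.\<close>

lemma avoids123_swap_iff:
  assumes d: "distinct xs" and av: "avoids123 xs" and ab: "a < b" "(a, b) \<in> before xs"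
  shows "avoids123 (map (transpose a b) xs) \<longleftrightarrow> (least_before xs a b \<or> below_after xs a b) \<and> (above_before xs a b \<or> greatest_after xs a b)"
proof
  note tr = before_trans[OF d] and asy = before_asym[OF d] and irr = before_irrefl[OF d]
  have av': "False" if "(x, y) \<in> before xs" "(y, z) \<in> before xs" "x < y" "y < z" for x y z
    using av that unfolding avoids123_def by blast
  {
    assume sw: "avoids123 (map (transpose a b) xs)"
    have sw': "False" if "(transpose a b x, transpose a b y) \<in> before xs"
        "(transpose a b y, transpose a b z) \<in> before xs" "x < y" "y < z" for x y z
      using sw that unfolding avoids123_def before_map_transpose by blast
    have "least_before xs a b \<or> below_after xs a b"
    proof (rule ccontr)
      assume "\<not> ?thesis"
      then obtain r r' where r: "(r, b) \<in> before xs" "r < a" "(b, r') \<in> before xs" "a \<le> r'"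
        unfolding least_before_def below_after_def by (meson not_le)
      have "r' \<noteq> a" using r ab asy by blast
      moreover have "r' \<noteq> b" using r irr by blast
      ultimately show False
        using sw'[of r a r'] r ab by (auto simp: transpose_def)
    qed
    moreover have "above_before xs a b \<or> greatest_after xs a b"
    proof (rule ccontr)
      assume "\<not> ?thesis"
      then obtain r r' where r: "(r, a) \<in> before xs" "r \<le> b" "(a, r') \<in> before xs" "b < r'"
        unfolding above_before_def greatest_after_def by (meson not_le)
      have "r \<noteq> b" using r ab asy by blast
      moreover have "r \<noteq> a" using r irr by blast
      ultimately show False
        using sw'[of r b r'] r ab by (auto simp: transpose_def)
    qed
    ultimately show "(least_before xs a b \<or> below_after xs a b) \<and> (above_before xs a b \<or> greatest_after xs a b)" ..
  }
  assume c: "(least_before xs a b \<or> below_after xs a b) \<and> (above_before xs a b \<or> greatest_after xs a b)"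
  have "False" if h: "(transpose a b x, transpose a b y) \<in> before xs"
      "(transpose a b y, transpose a b z) \<in> before xs" "x < y" "y < z" for x y z
  proof -
    \<comment> \<open>In the transposed list \<open>b\<close> precedes \<open>a\<close>, so no
      increasing triple there contains both.\<close>
    have ba: "(b, a) \<notin> before xs" using asy ab by blast
    consider "y = a" | "y = b" | "y \<noteq> a" "y \<noteq> b" "x = a" | "y \<noteq> a" "y \<noteq> b" "x = b"
      | "y \<noteq> a" "y \<noteq> b" "x \<noteq> a" "x \<noteq> b" "z = a" | "y \<noteq> a" "y \<noteq> b" "x \<noteq> a" "x \<noteq> b" "z = b"
      | "y \<noteq> a" "y \<noteq> b" "x \<noteq> a" "x \<noteq> b" "z \<noteq> a" "z \<noteq> b" by metis
    then show False
    proof cases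
      case 1
      then have "z \<noteq> b" using h ba by auto
      then have "(x, b) \<in> before xs" "(b, z) \<in> before xs" using h 1 ab by (auto simp: transpose_def)
      then show False using c h 1 unfolding least_before_def below_after_def by (meson not_le less_asym)
    next
      case 2
      then have "x \<noteq> a" using h ba by auto
      then have "(x, a) \<in> before xs" "(a, z) \<in> before xs" using h 2 ab by (auto simp: transpose_def)
      then show False using c h 2 unfolding above_before_def greatest_after_def by (meson not_le less_asym)
    next
      case 3
      have "z \<noteq> b" using h 3 ba tr[of b y a] by (auto simp: transpose_def)
      then show False using h 3 av'[of a y z] tr[of a b y] ab by (auto simp: transpose_def)
    next
      case 4
      then show False using h av'[of a y z] ab by (auto simp: transpose_def)
    next
      case 5
      then show False using h av'[of x y b] ab by (auto simp: transpose_def)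
    next
      case 6
      then show False using h av'[of x y b] tr[of y a b] ab by (auto simp: transpose_def)
    next
      case 7
      then show False using h av'[of x y z] by (auto simp: transpose_def)
    qed
  qed
  then show "avoids123 (map (transpose a b) xs)"
    unfolding avoids123_def before_map_transpose by blast
qed

subsection \<open>Reverse shuffle squares and 123-avoiding permutations\<close>

lemma sorted_wrt_map_strict_mono:
  assumes "strict_mono_on {1..n} (f :: nat \<Rightarrow> nat)" "f ` {1..n} \<subseteq> {1..m}"
  shows "sorted_wrt (<) (map (\<lambda>r. f (Suc r) - 1) [0..<n])"
proof -
  have "f (Suc i) - 1 < f (Suc j) - 1" if "i < j" "j < n" for i j
  proof -
    have "f (Suc i) < f (Suc j)" using assms(1) that by (auto simp: strict_mono_on_def)
    moreover have "Suc i \<in> {1..n}" using that by auto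
    then have "f (Suc i) \<in> {1..m}" using assms(2) by blast
    ultimately show ?thesis by auto
  qed
  then show ?thesis by (auto simp: sorted_wrt_iff_nth_less)
qed

text \<open>The enumerating functions become strictly increasing lists of 0-based positions, and the
  reflection \<open>n + 1 - r\<close> becomes \<open>rev\<close>.\<close>

lemma reverse_shuffle_square_iff_lists:
  "reverse_shuffle_square n s \<longleftrightarrow> length s = 2 * n \<and>
     (\<exists>is js. length is = n \<and> length js = n \<and> sorted_wrt (<) is \<and> sorted_wrt (<) js \<and>
        set is \<subseteq> {..<2 * n} \<and> set js \<subseteq> {..<2 * n} \<and> set is \<inter> set js = {} \<and>
        map ((!) s) is = rev (map ((!) s) js))" (is "?l \<longleftrightarrow> ?r")
proof
  assume ?l
  then obtain i j where ij: "length s = 2 * n" "strict_mono_on {1..n} i" "strict_mono_on {1..n} j"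
    "i ` {1..n} \<subseteq> {1..2 * n}" "j ` {1..n} \<subseteq> {1..2 * n}" "i ` {1..n} \<inter> j ` {1..n} = {}"
    "\<forall>r\<in>{1..n}. s ! (i r - 1) = s ! (j (n + 1 - r) - 1)"
    unfolding reverse_shuffle_square_def by (elim conjE exE) (rule that; assumption)
  define is' where "is' = map (\<lambda>r. i (Suc r) - 1) [0..<n]"
  define js' where "js' = map (\<lambda>r. j (Suc r) - 1) [0..<n]"
  have ran: "i (Suc r) \<in> {1..2 * n}" "j (Suc r) \<in> {1..2 * n}" if "r < n" for r
    using subsetD[OF ij(4), of "i (Suc r)"] subsetD[OF ij(5), of "j (Suc r)"] that by simp_all
  have "set is' \<inter> set js' = {}"
  proof -
    have "i (Suc r) - 1 \<noteq> j (Suc t) - 1" if "r < n" "t < n" for r t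
    proof -
      have "Suc r \<in> {1..n}" "Suc t \<in> {1..n}" using that by auto
      then have "i (Suc r) \<noteq> j (Suc t)" using ij(6) by blast
      then show ?thesis using ran(1)[OF that(1)] ran(2)[OF that(2)] by auto
    qed
    then show ?thesis unfolding is'_def js'_def by auto
  qed
  moreover have "map ((!) s) is' = rev (map ((!) s) js')"
  proof (rule nth_equalityI)
    fix r assume "r < length (map ((!) s) is')"
    then have r: "r < n" by (simp add: is'_def)
    then have "n - r = Suc (n - Suc r)" by simp
    then have "n + 1 - Suc r = Suc (n - Suc r)" by simp
    then show "map ((!) s) is' ! r = rev (map ((!) s) js') ! r"
      using r bspec[OF ij(7), of "Suc r"] by (simp add: is'_def js'_def rev_nth)
  qed (simp add: is'_def js'_def)
  moreover have "set is' \<subseteq> {..<2 * n}" "set js' \<subseteq> {..<2 * n}"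
    using ran unfolding is'_def js'_def by (auto simp: less_diff_conv2 less_Suc_eq_le)
  ultimately show ?r
    using ij(1) sorted_wrt_map_strict_mono[OF ij(2,4)] sorted_wrt_map_strict_mono[OF ij(3,5)]
    by (intro conjI exI[of _ is'] exI[of _ js']) (auto simp: is'_def js'_def)
next
  assume ?r
  then obtain xs ys where xy: "length s = 2 * n" "length xs = n" "length ys = n"
    "sorted_wrt (<) xs" "sorted_wrt (<) ys" "set xs \<subseteq> {..<2 * n}" "set ys \<subseteq> {..<2 * n}"
    "set xs \<inter> set ys = {}" "map ((!) s) xs = rev (map ((!) s) ys)" by blast
  define i where "i = (\<lambda>r. Suc (xs ! (r - 1)))"
  define j where "j = (\<lambda>r. Suc (ys ! (r - 1)))"
  have mono: "strict_mono_on {1..n} (\<lambda>r. Suc (zs ! (r - 1)))"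
    if "length zs = n" "sorted_wrt (<) zs" for zs :: "nat list"
    using that by (auto simp: strict_mono_on_def sorted_wrt_iff_nth_less)
  have im: "(\<lambda>r. Suc (zs ! (r - 1))) ` {1..n} = Suc ` set zs" if "length zs = n" for zs :: "nat list"
  proof -
    have "{1..n} = Suc ` {..<n}" by (simp add: image_Suc_lessThan)
    then show ?thesis using that by (auto simp: image_image set_conv_nth)
  qed
  have "s ! (i r - 1) = s ! (j (n + 1 - r) - 1)" if "r \<in> {1..n}" for r
  proof -
    obtain t where t: "r = Suc t" "t < n" using \<open>r \<in> {1..n}\<close> by (cases r) auto
    have "map ((!) s) xs ! t = rev (map ((!) s) ys) ! t" using xy(9) by simp
    then show ?thesis using t xy(2,3) by (simp add: i_def j_def rev_nth)
  qed
  moreover have "i ` {1..n} = Suc ` set xs" "j ` {1..n} = Suc ` set ys"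
    unfolding i_def j_def using im xy by auto
  moreover have "strict_mono_on {1..n} i" "strict_mono_on {1..n} j"
    unfolding i_def j_def using mono xy by auto
  ultimately show ?l
    unfolding reverse_shuffle_square_def using xy(1,6,7,8)
    by (intro conjI exI[of _ i] exI[of _ j]) auto
qed

text \<open>Place \<open>n + i\<close> of the second half is matched with place \<open>p ! i\<close>
  of the first. The left-to-right minima of \<open>p\<close> decrease, and so do the other entries,
  because an increasing pair among them would form a 123 with a smaller earlier entry. One class
  gives its lower places to \<open>is'\<close> and its upper places to \<open>js'\<close>, the other
  class does the opposite.\<close>

lemma reverse_shuffle_square_of_Av:
  assumes u: "length u = n" and p: "p \<in> Av n"
  shows "reverse_shuffle_square n (u @ map ((!) u) p)"
proof -
  define s where "s = u @ map ((!) u) p"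
  have lp: "length p = n" and d: "distinct p" and sp: "set p = {..<n}" and av: "avoids123 p"
    using p Av_length by (auto simp: Av_def)
  define P where "P = (\<lambda>i. \<forall>j<i. p ! i < p ! j)"
  define la where "la = filter P [0..<n]"
  define lb where "lb = filter (\<lambda>i. \<not> P i) [0..<n]"
  have sla: "set la = {i. i < n \<and> P i}" and slb: "set lb = {i. i < n \<and> \<not> P i}"
    by (auto simp: la_def lb_def)
  have dec_a: "p ! j < p ! i" if "i < j" "i \<in> set la" "j \<in> set la" for i j
    using that by (auto simp: sla P_def)
  have dec_b: "p ! j < p ! i" if "i < j" "i \<in> set lb" "j \<in> set lb" for i j
  proof -
    from that obtain h where h: "h < i" "p ! h \<le> p ! i" "i < n" "j < n"
      by (auto simp: slb P_def not_less)
    have "p ! h \<noteq> p ! i" "p ! i \<noteq> p ! j" using h that(1) d lp by (auto simp: nth_eq_iff_index_eq)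
    moreover have "(p ! h, p ! i) \<in> before p" "(p ! i, p ! j) \<in> before p"
      using h that(1) d lp by (auto simp: before_nth_iff)
    ultimately have "\<not> p ! i < p ! j" using av h(2) unfolding avoids123_def by (metis le_neq_implies_less)
    then show ?thesis using \<open>p ! i \<noteq> p ! j\<close> by simp
  qed
  have sorted_l: "sorted_wrt (<) (filter Q [0..<n])" for Q
    by (simp add: sorted_wrt_filter)
  have inc: "sorted_wrt (<) (map ((!) p) (rev l))"
    if "sorted_wrt (<) l" "\<And>i j. i < j \<Longrightarrow> i \<in> set l \<Longrightarrow> j \<in> set l \<Longrightarrow> p ! j < p ! i" for l
    using that
  proof (induction l)
    case (Cons a l)
    then have "sorted_wrt (<) (map ((!) p) (rev l))" by simp
    moreover have "\<forall>x\<in>set l. p ! x < p ! a" using Cons.prems by simp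
    ultimately show ?case by (simp add: sorted_wrt_append)
  qed simp
  have inc2: "sorted_wrt (<) (map ((+) n) l)" if "sorted_wrt (<) l" for l :: "nat list"
    using that by (induction l) auto
  have lt: "p ! i < n" if "i < n" for i using sp lp that nth_mem by fastforce
  have lt2: "p ! i < 2 * n" if "i < n" for i using lt[OF that] by simp
  \<comment> \<open>Lower places come first in both lists; \<open>rev\<close> makes them increasing
    because each class is decreasing.\<close>
  define is' where "is' = map ((!) p) (rev la) @ map ((+) n) lb"
  define js' where "js' = map ((!) p) (rev lb) @ map ((+) n) la"
  have len: "length la + length lb = n"
    using sum_length_filter_compl[of P "[0..<n]"] by (simp add: la_def lb_def)
  have sl: "sorted_wrt (<) la" "sorted_wrt (<) lb"
    using sorted_l by (auto simp: la_def lb_def)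
  have "\<forall>x\<in>set (map ((!) p) (rev l)). \<forall>y\<in>set (map ((+) n) l'). x < y"
    if "set l \<subseteq> {..<n}" for l l'
    using lt that by (auto simp: trans_less_add1)
  moreover have "set la \<subseteq> {..<n}" "set lb \<subseteq> {..<n}" by (auto simp: sla slb)
  ultimately have "sorted_wrt (<) is'" "sorted_wrt (<) js'"
    unfolding is'_def js'_def sorted_wrt_append
    using inc[OF sl(1) dec_a] inc[OF sl(2) dec_b] inc2[OF sl(1)] inc2[OF sl(2)] by blast+
  moreover have "set is' \<subseteq> {..<2 * n}" "set js' \<subseteq> {..<2 * n}"
    using lt2 by (auto simp: is'_def js'_def sla slb)
  moreover have "set is' \<inter> set js' = {}"
  proof -
    have 1: "p ! i \<noteq> p ! j" if "i \<in> set la" "j \<in> set lb" for i j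
      using that d lp nth_eq_iff_index_eq[OF d, of i j] by (auto simp: sla slb)
    have 2: "p ! i \<noteq> n + j" if "i \<in> set la \<union> set lb" for i j
      using lt[of i] that by (auto simp: sla slb)
    have 3: "set la \<inter> set lb = {}" by (auto simp: sla slb)
    have False if "x \<in> set is'" "x \<in> set js'" for x
    proof -
      consider i where "x = p ! i" "i \<in> set la" | i where "x = n + i" "i \<in> set lb"
        using \<open>x \<in> set is'\<close> by (auto simp: is'_def)
      moreover consider j where "x = p ! j" "j \<in> set lb" | j where "x = n + j" "j \<in> set la"
        using \<open>x \<in> set js'\<close> by (auto simp: js'_def)
      ultimately show False using 1 2 3 by (metis UnI1 UnI2 add_left_cancel disjoint_iff)
    qed
    then show ?thesis by blast
  qed
  moreover have "map ((!) s) is' = rev (map ((!) s) js')"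
  proof -
    have "s ! (p ! i) = s ! (n + i)" if "i < n" for i
      using that lt[OF that] u lp by (simp add: s_def nth_append)
    then show ?thesis unfolding is'_def js'_def
      by (auto simp: rev_map sla slb)
  qed
  moreover have "length is' = n" "length js' = n"
    using len by (auto simp: is'_def js'_def)
  moreover have "length s = 2 * n" using u lp by (simp add: s_def)
  ultimately show ?thesis
    unfolding s_def[symmetric] reverse_shuffle_square_iff_lists by blast
qed

text \<open>Pair \<open>r\<close> joins \<open>e r\<close> to \<open>d r\<close>, where
  \<open>e\<close> increases and \<open>d\<close> decreases, so any two of the intervals between
  partners overlap. This forces all lower ends into the first half. Pairs with
  \<open>e r < d r\<close> are nested in each other, and so are the remaining pairs, which gives two
  decreasing classes.\<close>

lemma Av_of_reverse_shuffle_square: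
  assumes "reverse_shuffle_square n s"
  shows "\<exists>p\<in>Av n. s = take n s @ map ((!) (take n s)) p"
proof -
  from assms obtain xs ys where xy: "length s = 2 * n" "length xs = n" "length ys = n"
    "sorted_wrt (<) xs" "sorted_wrt (<) ys" "set xs \<subseteq> {..<2 * n}" "set ys \<subseteq> {..<2 * n}"
    "set xs \<inter> set ys = {}" "map ((!) s) xs = rev (map ((!) s) ys)"
    unfolding reverse_shuffle_square_iff_lists by blast
  define e where "e = (!) xs"
  \<comment> \<open>The partner of \<open>e r\<close>: the reflection \<open>n + 1 - r\<close> when
    both ranges start at 0.\<close>
  define d where "d = (\<lambda>r. ys ! (n - Suc r))"
  have e_mono: "e r < e t" if "r < t" "t < n" for r t
    using xy(2,4) that by (simp add: e_def sorted_wrt_iff_nth_less)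
  have d_mono: "d t < d r" if "r < t" "t < n" for r t
    using xy(3,5) that by (simp add: d_def sorted_wrt_iff_nth_less diff_less_mono2)
  have ein: "e r \<in> set xs" and din: "d r \<in> set ys" if "r < n" for r
    using that xy(2,3) by (auto simp: e_def d_def)
  have ed: "e r \<noteq> d t" if "r < n" "t < n" for r t
    using ein[OF that(1)] din[OF that(2)] xy(8) by auto
  have lt2: "e r < 2 * n" "d r < 2 * n" if "r < n" for r
    using ein[OF that] din[OF that] xy(6,7) by auto
  have sed: "s ! e r = s ! d r" if "r < n" for r
  proof -
    have "map ((!) s) xs ! r = rev (map ((!) s) ys) ! r" using xy(9) by simp
    then show ?thesis using that xy(2,3) by (simp add: e_def d_def rev_nth)
  qed
  define m where "m = (\<lambda>r. min (e r) (d r))"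
  define M where "M = (\<lambda>r. max (e r) (d r))"
  \<comment> \<open>For \<open>r < t\<close> the increase of \<open>e\<close> separates the two
    ends, for \<open>t < r\<close> the decrease of \<open>d\<close>.\<close>
  have mM: "m r < M t" if "r < n" "t < n" for r t
  proof -
    consider "r < t" | "t < r" | "r = t" by linarith
    then show ?thesis
    proof cases
      case 1 then show ?thesis using e_mono[of r t] that by (auto simp: m_def M_def)
    next
      case 2 then show ?thesis using d_mono[of t r] that by (auto simp: m_def M_def)
    next
      case 3 then show ?thesis using ed[of r r] that by (auto simp: m_def M_def)
    qed
  qed
  have e_eq: "e r = e t \<longleftrightarrow> r = t" "d r = d t \<longleftrightarrow> r = t" if "r < n" "t < n" for r t
    using e_mono[of r t] e_mono[of t r] d_mono[of r t] d_mono[of t r] that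
    by (cases r t rule: linorder_cases; auto)+
  have "r = t" if "r < n" "t < n" "m r = m t \<or> M r = M t" for r t
    using e_eq[OF that(1,2)] ed[OF that(1,2)] ed[OF that(2,1)] that(3)
    by (auto simp: m_def M_def min_def max_def split: if_splits)
  then have inj_m: "inj_on m {..<n}" and inj_M: "inj_on M {..<n}"
    by (auto simp: inj_on_def)
  \<comment> \<open>The \<open>n\<close> distinct upper ends lie strictly between \<open>m r\<close>
    and \<open>2 * n\<close>, which leaves only values below \<open>n\<close> for
    \<open>m r\<close>; the bound on \<open>M r\<close> comes from the \<open>n\<close> lower ends
    below it.\<close>
  have m_lt: "m r < n" if "r < n" for r
  proof -
    have "M ` {..<n} \<subseteq> {m r <..< 2 * n}" using mM[OF that] lt2 by (auto simp: M_def)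
    then have "card (M ` {..<n}) \<le> 2 * n - Suc (m r)"
      using card_mono[of "{m r <..< 2 * n}"] by fastforce
    then show ?thesis using card_image[OF inj_M] that by simp
  qed
  have M_ge: "n \<le> M r" if "r < n" for r
  proof -
    have "m ` {..<n} \<subseteq> {..< M r}" using mM[OF _ that] by auto
    then have "card (m ` {..<n}) \<le> M r" using card_mono[of "{..< M r}"] by fastforce
    then show ?thesis using card_image[OF inj_m] by simp
  qed
  define N where "N = (\<lambda>r. M r - n)"
  have inj_N: "inj_on N {..<n}" unfolding N_def
    by (rule inj_onI) (metis M_ge inj_M inj_onD lessThan_iff le_add_diff_inverse)
  have N_lt: "N r < n" if "r < n" for r
    using lt2[OF that] M_ge[OF that] by (auto simp: N_def M_def)
  have "N ` {..<n} \<subseteq> {..<n}" "m ` {..<n} \<subseteq> {..<n}" using N_lt m_lt by auto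
  then have bij_N: "bij_betw N {..<n} {..<n}" and bij_m: "bij_betw m {..<n} {..<n}"
    using endo_inj_surj[OF finite_lessThan _ inj_N] endo_inj_surj[OF finite_lessThan _ inj_m]
      inj_N inj_m by (simp_all add: bij_betw_def)
  define R where "R = inv_into {..<n} N"
  have R: "R i < n" "N (R i) = i" if "i < n" for i
  proof -
    have "i \<in> N ` {..<n}" using bij_N that by (auto simp: bij_betw_def)
    then show "R i < n" "N (R i) = i" unfolding R_def
      using inv_into_into[of i N "{..<n}"] f_inv_into_f[of i N "{..<n}"] by auto
  qed
  have bij_R: "bij_betw R {..<n} {..<n}" unfolding R_def by (rule bij_betw_inv_into[OF bij_N])
  \<comment> \<open>Entry \<open>i\<close> is the lower end of the pair whose upper end is
    \<open>n + i\<close>.\<close>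
  define p where "p = map (m \<circ> R) [0..<n]"
  have bij_mR: "bij_betw (m \<circ> R) {..<n} {..<n}" using bij_betw_trans[OF bij_R bij_m] .
  have MR: "M (R i) = n + i" if "i < n" for i
    using R[OF that] M_ge[OF R(1)[OF that]] by (simp add: N_def)
  have "avoids123 p"
    unfolding avoids123_def
  proof (intro allI impI notI)
    fix x y z assume "(x, y) \<in> before p" "(y, z) \<in> before p" "x < y" "y < z"
    moreover from this obtain a b b' c where abc: "a < b" "b < n" "b' < c" "c < n"
        "m (R a) = x" "m (R b) = y" "m (R b') = y" "m (R c) = z"
      by (auto simp: before_iff_nth p_def)
    moreover have "b = b'"
      using inj_onD[OF bij_betw_imp_inj_on[OF bij_mR], of b b'] abc by simp
    ultimately have abc: "a < b" "b < c" "c < n" "m (R a) < m (R b)" "m (R b) < m (R c)" by auto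
    have lR: "R a < n" "R b < n" "R c < n" and mx: "M (R a) < M (R b)" "M (R b) < M (R c)"
      using abc R MR by auto
    \<comment> \<open>Within one orientation the lower and upper ends move in opposite directions,
      and two of any three pairs share their orientation.\<close>
    have no: "False" if "r < n" "t < n" "m r < m t" "M r < M t" "e r < d r \<longleftrightarrow> e t < d t" for r t
      using that e_mono[of r t] e_mono[of t r] d_mono[of r t] d_mono[of t r]
      by (cases r t rule: linorder_cases) (auto simp: m_def M_def min_def max_def split: if_splits)
    show False
      using no[of "R a" "R b"] no[of "R b" "R c"] no[of "R a" "R c"] lR mx abc
      by (cases "e (R a) < d (R a)"; cases "e (R b) < d (R b)"; cases "e (R c) < d (R c)") auto
  qed
  moreover have "distinct p" "set p = {..<n}"
    using bij_mR by (auto simp: p_def distinct_map bij_betw_def lessThan_atLeast0)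
  ultimately have "p \<in> Av n" by (simp add: Av_def)
  moreover have "s = take n s @ map ((!) (take n s)) p"
  proof (rule nth_equalityI)
    show "length s = length (take n s @ map ((!) (take n s)) p)" using xy(1) by (simp add: p_def)
  next
    fix i assume i: "i < length s"
    show "s ! i = (take n s @ map ((!) (take n s)) p) ! i"
    proof (cases "i < n")
      case False
      define h where "h = i - n"
      have h: "i = n + h" "h < n" using False i xy(1) by (auto simp: h_def)
      have "s ! M (R h) = s ! m (R h)"
        using sed[OF R(1)[OF h(2)]] by (auto simp: m_def M_def min_def max_def)
      then show ?thesis using h MR[OF h(2)] m_lt[OF R(1)[OF h(2)]] xy(1)
        by (simp add: nth_append p_def)
    qed (use i in \<open>simp add: nth_append\<close>)
  qed
  ultimately show ?thesis by blast
qed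

section \<open>Counting the squares by their first half\<close>

lemma RSS_eq: "RSS k n = (\<lambda>(u, p). u @ map ((!) u) p) ` (words k n \<times> Av n)"
proof (intro equalityI subsetI)
  fix s assume s: "s \<in> RSS k n"
  then have "take n s \<in> words k n"
    using set_take_subset[of n s] by (auto simp: RSS_def words_def)
  moreover obtain p where "p \<in> Av n" "s = take n s @ map ((!) (take n s)) p"
    using Av_of_reverse_shuffle_square s by (auto simp: RSS_def)
  ultimately show "s \<in> (\<lambda>(u, p). u @ map ((!) u) p) ` (words k n \<times> Av n)" by force
next
  fix s assume "s \<in> (\<lambda>(u, p). u @ map ((!) u) p) ` (words k n \<times> Av n)"
  then obtain u p where s: "s = u @ map ((!) u) p" "u \<in> words k n" "p \<in> Av n" by auto
  then have l: "length u = n" "set u \<subseteq> {0..<k}" "set p = {..<n}" "length p = n"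
    using Av_length by (auto simp: words_def Av_def)
  then have "set (map ((!) u) p) \<subseteq> {0..<k}" by (auto simp: subset_iff)
  then show "s \<in> RSS k n"
    using reverse_shuffle_square_of_Av[OF l(1) s(3)] s(1) l by (auto simp: RSS_def words_def)
qed

lemma finite_words: "finite (words k n)"
  using finite_lists_length_eq[of "{0..<k}" n] by (simp add: words_def conj_commute)

lemma card_words: "card (words k n) = k ^ n"
  using card_lists_length_eq[of "{0..<k}" n] by (simp add: words_def conj_commute)

lemma card_RSS: "card (RSS k n) = (\<Sum>u\<in>words k n. card ((\<lambda>p. map ((!) u) p) ` Av n))"
proof -
  have "RSS k n = (\<Union>u\<in>words k n. (@) u ` (\<lambda>p. map ((!) u) p) ` Av n)"
    by (auto simp: RSS_eq)
  also have "card \<dots> = (\<Sum>u\<in>words k n. card ((@) u ` (\<lambda>p. map ((!) u) p) ` Av n))"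
  proof (rule card_UN_disjoint)
    show "\<forall>u\<in>words k n. \<forall>v\<in>words k n. u \<noteq> v \<longrightarrow>
        (@) u ` (\<lambda>p. map ((!) u) p) ` Av n \<inter> (@) v ` (\<lambda>p. map ((!) v) p) ` Av n = {}"
      by (auto simp: words_def)
  qed (simp_all add: finite_words finite_Av)
  also have "\<dots> = (\<Sum>u\<in>words k n. card ((\<lambda>p. map ((!) u) p) ` Av n))"
    by (intro sum.cong refl card_image) (auto simp: inj_on_def)
  finally show ?thesis .
qed

subsection \<open>Ballot numbers\<close>

text \<open>
  \<open>ballot k m\<close> is the number of paths of length \<open>k\<close> from \<open>m\<close> with steps from \<open>i\<close> to any
  \<open>j \<in> {1..i + 1}\<close>.
\<close>
fun ballot :: "nat \<Rightarrow> nat \<Rightarrow> nat" where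
  "ballot 0 m = 1"
| "ballot (Suc k) 0 = ballot k 1"
| "ballot (Suc k) (Suc m) = ballot (Suc k) m + ballot k (Suc (Suc m))"

abbreviation catalan :: "nat \<Rightarrow> nat" where
  "catalan n \<equiv> ballot n 0"

lemma ballot_Suc_sum: "ballot (Suc k) m = (\<Sum>j=1..Suc m. ballot k j)"
  by (induction m) auto

lemma ballot_1: "ballot (Suc 0) m = Suc m"
  by (induction m) auto

text \<open>The reflection formula for ballot numbers, in additive form to avoid subtraction on
  naturals. Both sides follow Pascal's rule along the recursion of \<open>ballot\<close>.\<close>

lemma ballot_closed_form:
  "ballot k m + (if k = 0 then 0 else (2 * k + m) choose (k - 1)) = (2 * k + m) choose k"
proof (induction k m rule: ballot.induct)
  case (2 k)
  show ?case
  proof (cases k)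
    case (Suc l)
    \<comment> \<open>At \<open>m = 0\<close> the two middle binomials of an odd row have to
      agree.\<close>
    have "(2 * l + 3) choose (Suc (Suc l)) = (2 * l + 3) choose (Suc l)"
      using binomial_symmetric[of "Suc l" "2 * l + 3"] by simp
    then show ?thesis using 2 Suc by (simp add: numeral_3_eq_3 numeral_2_eq_2)
  qed simp
next
  case (3 k m)
  show ?case
  proof (cases k)
    case (Suc l)
    then show ?thesis using 3 by (simp add: numeral_2_eq_2)
  qed (use 3 in simp)
qed simp

text \<open>For \<open>n = k + 1\<close> the two binomials of \<open>ballot_closed_form\<close> at
  \<open>m = 0\<close> are in the ratio \<open>k + 1\<close> to \<open>k + 2\<close>, so their
  difference is the central one divided by \<open>k + 2\<close>.\<close>

lemma catalan_closed_form: "(n + 1) * catalan n = (2 * n) choose n"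
proof (cases n)
  case (Suc k)
  have "Suc k * ((2 * k + 2) choose Suc k) = (k + 2) * ((2 * k + 2) choose k)"
    using binomial_absorption[of k "2 * k + 2"] binomial_absorb_comp[of "2 * k + 2" k] by simp
  moreover have "catalan n + ((2 * k + 2) choose k) = (2 * k + 2) choose Suc k"
    using ballot_closed_form[of n 0] Suc by simp
  moreover have "(k + 2) * catalan n = c2" if "Suc k * c2 = (k + 2) * c1" "catalan n + c1 = c2" for c1 c2
    using that by (auto simp: algebra_simps)
  ultimately have "(k + 2) * catalan n = (2 * k + 2) choose Suc k"
    by blast
  then show ?thesis using Suc by simp
qed simp

text \<open>In terms of generating functions in \<open>k\<close>, \<open>ballot k m\<close> belongs
  to the power \<open>m + 1\<close> of the Catalan series, and convolving with
  \<open>catalan\<close> raises the exponent by one.\<close>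

lemma ballot_convolution: "(\<Sum>i\<le>k. ballot i m * catalan (k - i)) = ballot k (Suc m)"
proof (induction k m rule: ballot.induct)
  case (2 k)
  then show ?case by (simp add: sum.atMost_Suc_shift del: sum.atMost_Suc)
next
  case (3 k m)
  have "(\<Sum>i\<le>Suc k. ballot i (Suc m) * catalan (Suc k - i)) =
      (\<Sum>i\<le>Suc k. ballot i m * catalan (Suc k - i)) + (\<Sum>i\<le>k. ballot i (Suc (Suc m)) * catalan (k - i))"
    by (simp add: sum.atMost_Suc_shift sum.distrib add_mult_distrib del: sum.atMost_Suc)
  then show ?case using 3 by simp
qed simp

lemma catalan_convolution: "(\<Sum>i\<le>n. catalan i * catalan (n - i)) = catalan (Suc n)"
  using ballot_convolution[of 0 n] by simp

subsection \<open>Inserting the largest entry\<close>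

fun run :: "nat list \<Rightarrow> nat" where
  "run [] = 0"
| "run [x] = 1"
| "run (x # y # zs) = (if y < x then Suc (run (y # zs)) else 1)"

lemma run_le_length: "run xs \<le> length xs"
  by (induction xs rule: run.induct) auto

text \<open>This identifies the indices at which a new largest entry can be inserted as
  \<open>{..run xs}\<close>.\<close>

lemma sorted_take_iff_run: "j \<le> length xs \<Longrightarrow> sorted_wrt (>) (take j xs) \<longleftrightarrow> j \<le> run xs"
proof (induction xs arbitrary: j rule: run.induct)
  case (2 x)
  then show ?case by (cases j) auto
next
  case (3 x y zs)
  have tr: "transp ((>) :: nat \<Rightarrow> nat \<Rightarrow> bool)" by (auto intro: transpI)
  show ?case
  proof (cases j)
    case (Suc i)
    then show ?thesis
    proof (cases i)
      case (Suc l)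
      have "sorted_wrt (>) (take j (x # y # zs)) \<longleftrightarrow> y < x \<and> sorted_wrt (>) (take i (y # zs))"
        using sorted_wrt2[OF tr] \<open>j = Suc i\<close> Suc by simp
      then show ?thesis
        using 3(1)[of i] 3(2) \<open>j = Suc i\<close> Suc by (cases "y < x") simp_all
    qed auto
  qed simp
qed simp

definition ins :: "nat \<Rightarrow> nat \<Rightarrow> nat list \<Rightarrow> nat list" where
  "ins n j xs = take j xs @ n # drop j xs"

lemma run_Cons_max: "\<forall>x\<in>set xs. x < n \<Longrightarrow> run (n # xs) = Suc (run xs)"
  by (cases xs) auto

text \<open>At index 0 the new largest entry lengthens the run; at \<open>j > 0\<close> it ends the
  run after \<open>j\<close> entries. Hence the children of state \<open>run xs\<close> are the
  states from 1 to \<open>run xs + 1\<close>, exactly the steps of \<open>ballot\<close>.\<close>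

lemma run_ins:
  assumes "\<forall>x\<in>set xs. x < n" "j \<le> run xs"
  shows "run (ins n j xs) = (if j = 0 then Suc (run xs) else j)"
proof (cases "j = 0")
  case False
  have jl: "j \<le> length xs" using assms(2) run_le_length[of xs] by simp
  have l: "length (ins n j xs) = Suc (length xs)" by (simp add: ins_def)
  have "take j (ins n j xs) = take j xs" using jl by (simp add: ins_def)
  then have 1: "j \<le> run (ins n j xs)"
    using sorted_take_iff_run[of j "ins n j xs"] sorted_take_iff_run[of j xs] assms(2) jl l by simp
  have t: "take (Suc j) (ins n j xs) = take j xs @ [n]" using jl by (simp add: ins_def)
  have "take j xs \<noteq> []" using False jl by auto
  then have "hd (take j xs) \<in> set (take j xs)" by (rule hd_in_set)
  then have "hd (take j xs) < n" using assms(1) in_set_takeD by fast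
  then have "\<not> sorted_wrt (>) (take j xs @ [n])"
    using \<open>hd (take j xs) \<in> set (take j xs)\<close> unfolding sorted_wrt_append by fastforce
  then have "\<not> Suc j \<le> run (ins n j xs)"
    using sorted_take_iff_run[of "Suc j" "ins n j xs"] t l jl by simp
  then show ?thesis using 1 False by simp
qed (use assms in \<open>simp add: ins_def run_Cons_max\<close>)

lemma sorted_wrt_iff_before: "sorted_wrt P xs \<longleftrightarrow> (\<forall>x y. (x, y) \<in> before xs \<longrightarrow> P x y)"
  by (induction xs) auto

text \<open>The largest entry can only be the last of an increasing triple, so the prefix in front
  of it must contain no increasing pair.\<close>

lemma avoids123_insert_max:
  assumes "\<forall>x\<in>set (ys @ zs). x < n" and d: "distinct (ys @ zs)"
  shows "avoids123 (ys @ n # zs) \<longleftrightarrow> avoids123 (ys @ zs) \<and> sorted_wrt (>) ys" (is "?l \<longleftrightarrow> ?r")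
proof
  assume l: ?l
  have "y < x" if "(x, y) \<in> before ys" for x y
  proof (rule ccontr)
    assume "\<not> y < x"
    moreover have "x \<noteq> y" using that before_irrefl d by fastforce
    moreover have "(x, y) \<in> before (ys @ n # zs)" "(y, n) \<in> before (ys @ n # zs)" "y < n"
      using that before_set[OF that] assms(1) by (auto simp: before_append)
    ultimately show False using l unfolding avoids123_def by (meson linorder_neqE_nat)
  qed
  then show ?r using l unfolding sorted_wrt_iff_before avoids123_def before_insert by blast
next
  assume r: ?r
  show ?l unfolding avoids123_def
  proof (intro allI impI notI)
    fix x y z assume h: "(x, y) \<in> before (ys @ n # zs)" "(y, z) \<in> before (ys @ n # zs)" "x < y" "y < z"
    have "z \<le> n" using before_set[OF h(2)] assms(1) by (auto intro: less_imp_le)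
    then have xy: "(x, y) \<in> before (ys @ zs)" using h by (auto simp: before_insert dest: before_set)
    show False
    proof (cases "z = n")
      case True
      have "n \<notin> set (ys @ zs)" using assms by auto
      then have "y \<in> set ys" using h True by (auto simp: before_insert dest: before_set)
      then have "(x, y) \<in> before ys" using xy d by (auto simp: before_append dest: before_set)
      then show False using r h(3) unfolding sorted_wrt_iff_before by (meson less_asym)
    next
      case False
      then have "(y, z) \<in> before (ys @ zs)" using h \<open>z \<le> n\<close> by (auto simp: before_insert)
      then show False using r xy h unfolding avoids123_def by blast
    qed
  qed
qed

text \<open>The inverse deletes \<open>n\<close> and recovers the index by counting the entries
  before it.\<close>

lemma Av_Suc_bij:
  "bij_betw (\<lambda>(p, j). ins n j p) (SIGMA p:Av n. {..run p}) (Av (Suc n))"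
proof (rule bij_betw_byWitness[where f' = "\<lambda>q. (filter (\<lambda>x. x \<noteq> n) q, length (takeWhile (\<lambda>x. x \<noteq> n) q))"])
  have key: "(case (case x of (p, j) \<Rightarrow> ins n j p) of q \<Rightarrow>
      (filter (\<lambda>x. x \<noteq> n) q, length (takeWhile (\<lambda>x. x \<noteq> n) q))) = x \<and>
      (case x of (p, j) \<Rightarrow> ins n j p) \<in> Av (Suc n)" if x: "x \<in> (SIGMA p:Av n. {..run p})" for x
  proof -
    obtain p j where x: "x = (p, j)" "p \<in> Av n" "j \<le> run p" using x by auto
    have p: "distinct p" "set p = {..<n}" "avoids123 p" using x(2) by (auto simp: Av_def)
    have jl: "j \<le> length p" using x(3) run_le_length[of p] by simp
    have nt: "\<forall>x\<in>set (take j p). x \<noteq> n" "\<forall>x\<in>set (drop j p). x \<noteq> n"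
      using p(2) in_set_takeD in_set_dropD by fastforce+
    have "filter (\<lambda>x. x \<noteq> n) (ins n j p) = p" using nt by (simp add: ins_def)
    moreover have "length (takeWhile (\<lambda>x. x \<noteq> n) (ins n j p)) = j"
      using nt jl by (simp add: ins_def takeWhile_append2)
    moreover have "avoids123 (ins n j p)"
      unfolding ins_def using avoids123_insert_max[of "take j p" "drop j p" n] p sorted_take_iff_run[OF jl] x(3)
      by simp
    moreover have "set (ins n j p) = insert n (set (take j p @ drop j p))"
      unfolding ins_def set_append by auto
    then have "set (ins n j p) = {..<Suc n}" unfolding append_take_drop_id p(2) lessThan_Suc .
    moreover have "distinct (ins n j p)"
    proof -
      have "distinct (take j p @ drop j p)" using p(1) by simp
      then show ?thesis using nt unfolding ins_def distinct_append by auto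
    qed
    ultimately show ?thesis using x(1) by (simp add: Av_def)
  qed
  show "\<forall>x\<in>SIGMA p:Av n. {..run p}.
      (filter (\<lambda>x. x \<noteq> n) (case x of (p, j) \<Rightarrow> ins n j p),
       length (takeWhile (\<lambda>x. x \<noteq> n) (case x of (p, j) \<Rightarrow> ins n j p))) = x"
    using key by simp
  show "(\<lambda>(p, j). ins n j p) ` (SIGMA p:Av n. {..run p}) \<subseteq> Av (Suc n)"
    using key by blast
  have key2: "ins n (length (takeWhile (\<lambda>x. x \<noteq> n) q)) (filter (\<lambda>x. x \<noteq> n) q) = q \<and>
      filter (\<lambda>x. x \<noteq> n) q \<in> Av n \<and>
      length (takeWhile (\<lambda>x. x \<noteq> n) q) \<le> run (filter (\<lambda>x. x \<noteq> n) q)" if q: "q \<in> Av (Suc n)" for q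
  proof -
    have q': "distinct q" "set q = {..<Suc n}" "avoids123 q" using q by (auto simp: Av_def)
    then obtain ys zs where s: "q = ys @ n # zs" by (metis lessI lessThan_iff split_list)
    have nt: "n \<notin> set ys" "n \<notin> set zs" using q'(1) s by auto
    have f: "filter (\<lambda>x. x \<noteq> n) ys = ys" "filter (\<lambda>x. x \<noteq> n) zs = zs"
      using nt by (auto simp: filter_id_conv)
    have "takeWhile (\<lambda>x. x \<noteq> n) (ys @ n # zs) = ys @ takeWhile (\<lambda>x. x \<noteq> n) (n # zs)"
      by (rule takeWhile_append2) (use nt in auto)
    then have t: "takeWhile (\<lambda>x. x \<noteq> n) q = ys" using s by simp
    have "insert n (set (ys @ zs)) = insert n {..<n}" using q'(2) s by (simp add: lessThan_Suc)
    then have st: "set (ys @ zs) = {..<n}" using nt by (metis Un_iff insert_ident lessThan_iff less_irrefl set_append)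
    have d: "distinct (ys @ zs)" using q'(1) s by auto
    have av: "avoids123 (ys @ zs)" "sorted_wrt (>) ys"
      using avoids123_insert_max[of ys zs n, OF _ d] q'(3) s st by simp_all
    have "length ys \<le> run (ys @ zs)" using av sorted_take_iff_run[of "length ys" "ys @ zs"] by simp
    then show ?thesis using s f t st d av by (simp add: ins_def Av_def)
  qed
  show "\<forall>q\<in>Av (Suc n). (case (filter (\<lambda>x. x \<noteq> n) q, length (takeWhile (\<lambda>x. x \<noteq> n) q)) of
      (p, j) \<Rightarrow> ins n j p) = q"
    using key2 by simp
  show "(\<lambda>q. (filter (\<lambda>x. x \<noteq> n) q, length (takeWhile (\<lambda>x. x \<noteq> n) q))) ` Av (Suc n)
      \<subseteq> (SIGMA p:Av n. {..run p})"
    using key2 by auto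
qed

lemma sum_Av_Suc: "(\<Sum>q\<in>Av (Suc n). f q) = (\<Sum>p\<in>Av n. \<Sum>j\<le>run p. f (ins n j p))"
proof -
  have "(\<Sum>p\<in>Av n. \<Sum>j\<le>run p. f (ins n j p)) = (\<Sum>(p, j)\<in>(SIGMA p:Av n. {..run p}). f (ins n j p))"
    by (rule sum.Sigma) (auto simp: finite_Av)
  also have "\<dots> = (\<Sum>q\<in>Av (Suc n). f q)"
    using sum.reindex_bij_betw[OF Av_Suc_bij[of n], of f] by (simp add: case_prod_unfold)
  finally show ?thesis by simp
qed

lemma Av_lt: "p \<in> Av n \<Longrightarrow> \<forall>x\<in>set p. x < n"
  by (auto simp: Av_def)

lemma sum_atMost_split: "(\<Sum>j\<le>m. f j) = f 0 + (\<Sum>j=1..m. f j)" for f :: "nat \<Rightarrow> nat"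
  by (simp add: sum.atMost_shift sum.atLeast1_atMost_eq)

lemma sum_ballot_ins:
  assumes "p \<in> Av n"
  shows "(\<Sum>j\<le>run p. ballot k (run (ins n j p))) = ballot (Suc k) (run p)"
proof -
  have "(\<Sum>j=1..run p. ballot k (run (ins n j p))) = (\<Sum>j=1..run p. ballot k j)"
    using run_ins[OF Av_lt[OF assms]] by (intro sum.cong) auto
  then show ?thesis
    using run_ins[OF Av_lt[OF assms], of 0] by (simp add: sum_atMost_split ballot_Suc_sum del: ballot.simps)
qed

text \<open>\<open>ballot k (run p)\<close> counts the descendants of \<open>p\<close> after
  \<open>k\<close> more insertions. Trading one level of \<open>n\<close> for one of
  \<open>k\<close> keeps \<open>n + k\<close> fixed, down to the empty list.\<close>

lemma sum_ballot_run: "(\<Sum>p\<in>Av n. ballot k (run p)) = catalan (n + k)"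
proof (induction n arbitrary: k)
  case 0
  then show ?case by (simp add: Av_0)
next
  case (Suc n)
  have "(\<Sum>p\<in>Av (Suc n). ballot k (run p)) = (\<Sum>p\<in>Av n. ballot (Suc k) (run p))"
    by (simp add: sum_Av_Suc sum_ballot_ins del: ballot.simps)
  then show ?case using Suc[of "Suc k"] by (simp del: ballot.simps)
qed

lemma card_Av: "card (Av n) = catalan n"
  using sum_ballot_run[of 0 n] by simp

text \<open>A permutation \<open>p\<close> has \<open>run p + 1\<close> children, which is
  \<open>ballot 1 (run p)\<close>.\<close>

lemma sum_run: "(\<Sum>p\<in>Av n. run p) + catalan n = catalan (Suc n)"
  using sum_ballot_run[of 1 n] card_Av[of n] ballot_1 by (simp add: sum_Suc)

subsection \<open>Transpositions under insertion of the largest entry\<close>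

text \<open>For 123-avoiding \<open>xs\<close> these are the members of \<open>swaps xs\<close>
  satisfying the first alternative of the second factor in \<open>avoids123_swap_iff\<close>.
  Together with \<open>greatest_pairs\<close> they exhaust \<open>swaps xs\<close>, with overlap
  \<open>both_pairs\<close>.\<close>

definition above_pairs :: "nat list \<Rightarrow> (nat \<times> nat) set" where
  "above_pairs xs = {(a, b). a < b \<and> (a, b) \<in> before xs \<and> above_before xs a b \<and> (least_before xs a b \<or> below_after xs a b)}"

definition both_pairs :: "nat list \<Rightarrow> (nat \<times> nat) set" where
  "both_pairs xs = {(a, b). (a, b) \<in> above_pairs xs \<and> greatest_after xs a b}"

text \<open>Inserting the largest entry \<open>n\<close> at index \<open>j\<close> creates the new pair \<open>(hd p, n)\<close> or none.\<close>
definition mark :: "nat list \<Rightarrow> nat \<Rightarrow> bool" where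
  "mark p j \<longleftrightarrow> j = 1 \<or> (j \<noteq> 0 \<and> hd p = length p - 1)"

context
  fixes ys zs :: "nat list" and n :: nat
  assumes d: "distinct (ys @ zs)" and lt: "\<forall>x\<in>set (ys @ zs). x < n" and so: "sorted_wrt (>) ys"
begin

lemma before_not_max: "(a, b) \<in> before (ys @ zs) \<Longrightarrow> a < n \<and> b < n"
  using lt before_set by fastforce

lemma before_decreasing_prefix: "(a, b) \<in> before (ys @ zs) \<Longrightarrow> b \<in> set ys \<Longrightarrow> b < a"
proof -
  assume h: "(a, b) \<in> before (ys @ zs)" "b \<in> set ys"
  then have "(a, b) \<in> before ys" using d by (auto simp: before_append dest: before_set)
  then show "b < a" using so unfolding sorted_wrt_iff_before by blast
qed

text \<open>If \<open>a < b\<close> and \<open>a\<close> precedes \<open>b\<close>, then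
  \<open>b\<close> is outside the decreasing prefix, so \<open>n\<close> stands before
  \<open>b\<close>. There it is too large to violate \<open>above_before\<close> or
  \<open>least_before\<close>, and \<open>below_after\<close> does not see it.\<close>

lemma above_pairs_insert_old:
  assumes "b \<noteq> n"
  shows "(a, b) \<in> above_pairs (ys @ n # zs) \<longleftrightarrow> (a, b) \<in> above_pairs (ys @ zs)"
proof (cases "a < b \<and> (a, b) \<in> before (ys @ zs)")
  case True
  have ab: "a < n" "b < n" "(a, b) \<in> before (ys @ n # zs)" "b \<notin> set ys"
    using True before_not_max[of a b] before_decreasing_prefix[of a b] by (auto simp: before_insert)
  have "above_before (ys @ n # zs) a b \<longleftrightarrow> above_before (ys @ zs) a b"
    using ab unfolding above_before_def before_insert by auto
  moreover have "least_before (ys @ n # zs) a b \<longleftrightarrow> least_before (ys @ zs) a b"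
    using ab unfolding least_before_def before_insert by auto
  moreover have "below_after (ys @ n # zs) a b \<longleftrightarrow> below_after (ys @ zs) a b"
    using ab unfolding below_after_def before_insert by auto
  ultimately show ?thesis using True ab by (auto simp: above_pairs_def)
next
  case False
  have "\<not> (a < b \<and> (a, b) \<in> before (ys @ n # zs))"
  proof
    assume h: "a < b \<and> (a, b) \<in> before (ys @ n # zs)"
    then have "b \<in> set (ys @ zs)" using before_set[of a b "ys @ n # zs"] assms by auto
    then have "b < n" using lt by blast
    then have "a \<noteq> n" using h by simp
    then show False using h False assms by (auto simp: before_insert)
  qed
  then show ?thesis using False by (auto simp: above_pairs_def)
qed

text \<open>For \<open>b = n\<close>, \<open>above_before\<close> says that nothing precedes
  \<open>a\<close>, so \<open>a = hd ys\<close>. As \<open>ys\<close> decreases, its head is its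
  least entry only when \<open>length ys = 1\<close>; the other case is
  \<open>below_after\<close>.\<close>

lemma above_pairs_insert_new:
  "(a, n) \<in> above_pairs (ys @ n # zs) \<longleftrightarrow>
    ys \<noteq> [] \<and> a = hd ys \<and> (length ys = 1 \<or> (\<forall>r\<in>set zs. r < hd ys))"
proof (cases ys)
  case Nil
  have "(a, n) \<notin> before (n # zs)" using lt Nil by (auto dest: before_set)
  then show ?thesis using Nil by (auto simp: above_pairs_def)
next
  case (Cons y vs)
  have nn: "n \<notin> set (ys @ zs)" using lt by auto
  have b1: "(r, n) \<in> before (ys @ n # zs) \<longleftrightarrow> r \<in> set ys" for r
    using nn before_not_max by (auto simp: before_insert dest: before_set)
  have b2: "(n, r) \<in> before (ys @ n # zs) \<longleftrightarrow> r \<in> set zs" for r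
    using nn by (auto simp: before_insert dest: before_set)
  have b3: "(\<forall>r. (r, a) \<in> before (ys @ n # zs) \<longrightarrow> n < r) \<longleftrightarrow> a = y" if "a \<in> set ys"
  proof
    assume h: "\<forall>r. (r, a) \<in> before (ys @ n # zs) \<longrightarrow> n < r"
    show "a = y"
    proof (rule ccontr)
      assume "a \<noteq> y"
      then have "(y, a) \<in> before (ys @ n # zs)" using that Cons by auto
      then show False using h lt Cons by fastforce
    qed
  next
    assume "a = y"
    then have "(r, a) \<notin> before (ys @ n # zs)" for r
      using d nn Cons by (auto dest: before_set)
    then show "\<forall>r. (r, a) \<in> before (ys @ n # zs) \<longrightarrow> n < r" by blast
  qed
  have b4: "(\<forall>r\<in>set ys. y \<le> r) \<longleftrightarrow> length ys = 1"
    using so Cons by (cases vs) auto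
  show ?thesis
  proof (cases "a = y")
    case True
    have "y < n" "y \<in> set ys" "ys \<noteq> []" "hd ys = y" using Cons lt by auto
    then show ?thesis
      using b3 b4 True by (simp add: above_pairs_def above_before_def least_before_def below_after_def b1 b2 Ball_def)
  next
    case False
    then have "\<not> ((a, n) \<in> before (ys @ n # zs) \<and> above_before (ys @ n # zs) a n)"
      using b3 unfolding b1 above_before_def by blast
    then show ?thesis using False Cons by (auto simp: above_pairs_def)
  qed
qed

lemma above_pairs_insert:
  "above_pairs (ys @ n # zs) = above_pairs (ys @ zs) \<union>
    (if ys \<noteq> [] \<and> (length ys = 1 \<or> (\<forall>r\<in>set zs. r < hd ys)) then {(hd ys, n)} else {})"
proof -
  have "(a, n) \<notin> above_pairs (ys @ zs)" for a
    using before_not_max by (auto simp: above_pairs_def)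
  then have "(a, b) \<in> above_pairs (ys @ n # zs) \<longleftrightarrow> (a, b) \<in> above_pairs (ys @ zs) \<union>
    (if ys \<noteq> [] \<and> (length ys = 1 \<or> (\<forall>r\<in>set zs. r < hd ys)) then {(hd ys, n)} else {})" for a b
    using above_pairs_insert_old[of b a] above_pairs_insert_new[of a] by (cases "b = n") auto
  then show ?thesis by (intro equalityI subrelI) (simp_all only:)
qed

text \<open>An old pair loses \<open>greatest_after\<close> exactly when \<open>n\<close> lands
  after \<open>a\<close>; a new pair has it because \<open>n\<close> is the maximum.\<close>

lemma both_pairs_insert:
  "both_pairs (ys @ n # zs) = {(a, b). (a, b) \<in> both_pairs (ys @ zs) \<and> a \<notin> set ys} \<union>
    (if ys \<noteq> [] \<and> (length ys = 1 \<or> (\<forall>r\<in>set zs. r < hd ys)) then {(hd ys, n)} else {})"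
proof -
  have 0: "(a, n) \<notin> above_pairs (ys @ zs)" for a
    using before_not_max by (auto simp: above_pairs_def)
  have 1: "greatest_after (ys @ n # zs) a b \<longleftrightarrow> greatest_after (ys @ zs) a b \<and> a \<notin> set ys" if "(a, b) \<in> above_pairs (ys @ zs)" for a b
  proof -
    have "a < n" "b < n" using that before_not_max by (auto simp: above_pairs_def)
    then show ?thesis unfolding greatest_after_def before_insert by auto
  qed
  have 2: "greatest_after (ys @ n # zs) a n" for a
  proof -
    have "r \<le> n" if "(a, r) \<in> before (ys @ n # zs)" for r
      using before_set[OF that] lt by (auto intro: less_imp_le)
    then show ?thesis by (auto simp: greatest_after_def)
  qed
  show ?thesis
    unfolding both_pairs_def above_pairs_insert using 0 1 2 by auto
qed

end

lemma finite_above_pairs: "finite (above_pairs p)"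
  by (rule finite_subset[of _ "set p \<times> set p"]) (auto simp: above_pairs_def dest: before_set)

lemma finite_both_pairs: "finite (both_pairs p)"
  by (rule finite_subset[OF _ finite_above_pairs[of p]]) (auto simp: both_pairs_def)

lemma above_pairs_lt: "p \<in> Av n \<Longrightarrow> (a, b) \<in> above_pairs p \<Longrightarrow> b < n"
  using Av_lt by (auto simp: above_pairs_def dest: before_set)

lemma
  assumes p: "p \<in> Av n" and j: "j \<le> run p"
  shows above_pairs_ins: "above_pairs (ins n j p) = above_pairs p \<union> (if mark p j then {(hd p, n)} else {})"
    and both_pairs_ins: "both_pairs (ins n j p) =
      {(a, b). (a, b) \<in> both_pairs p \<and> a \<notin> set (take j p)} \<union> (if mark p j then {(hd p, n)} else {})"
proof -
  have jl: "j \<le> length p" using j run_le_length[of p] by simp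
  have d: "distinct (take j p @ drop j p)" and lt: "\<forall>x\<in>set (take j p @ drop j p). x < n"
    and so: "sorted_wrt (>) (take j p)"
    using p Av_lt[OF p] sorted_take_iff_run[OF jl] j by (auto simp: Av_def)
  have "(take j p \<noteq> [] \<and> (length (take j p) = 1 \<or> (\<forall>r\<in>set (drop j p). r < hd (take j p)))) \<longleftrightarrow> mark p j"
  proof (cases j)
    case (Suc i)
    then obtain y vs where pc: "p = y # vs" using jl by (cases p) auto
    have sp: "set p = {..<n}" and dp: "distinct p" using p by (auto simp: Av_def)
    \<comment> \<open>The rest of the decreasing prefix is below \<open>y\<close> anyway, so the
      condition makes \<open>y\<close> the maximum, which is \<open>n - 1\<close> with
      \<open>n = length p\<close>.\<close>
    have "(\<forall>r\<in>set (drop j p). r < y) \<longleftrightarrow> y = length p - 1"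
    proof
      assume h: "\<forall>r\<in>set (drop j p). r < y"
      have "r \<le> y" if "r \<in> set p" for r
      proof -
        have "r \<in> set (take j p) \<or> r \<in> set (drop j p)"
          using that by (metis Un_iff append_take_drop_id set_append)
        moreover have "r \<le> y" if "r \<in> set (take j p)" using that so Suc pc by auto
        ultimately show ?thesis using h by auto
      qed
      moreover have "y < n" using Av_lt[OF p] pc by auto
      moreover from this have "n - 1 \<in> set p" unfolding sp by simp
      ultimately show "y = length p - 1" using Av_length[OF p] by fastforce
    next
      assume "y = length p - 1"
      then have y: "y = n - 1" using Av_length[OF p] by simp
      show "\<forall>r\<in>set (drop j p). r < y"
      proof
        fix r assume "r \<in> set (drop j p)"
        then have "r \<in> set vs" using Suc pc in_set_dropD by fastforce
        then have "r \<noteq> y" "r < n" using dp pc sp by auto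
        then show "r < y" using y by simp
      qed
    qed
    then show ?thesis using Suc pc jl by (auto simp: mark_def)
  qed (simp add: mark_def)
  moreover have "mark p j \<Longrightarrow> hd (take j p) = hd p" by (auto simp: mark_def)
  ultimately show "above_pairs (ins n j p) = above_pairs p \<union> (if mark p j then {(hd p, n)} else {})"
      "both_pairs (ins n j p) =
        {(a, b). (a, b) \<in> both_pairs p \<and> a \<notin> set (take j p)} \<union> (if mark p j then {(hd p, n)} else {})"
    unfolding ins_def using above_pairs_insert[OF d lt so] both_pairs_insert[OF d lt so] by auto
qed

lemma card_above_pairs_ins:
  assumes "p \<in> Av n" "j \<le> run p"
  shows "card (above_pairs (ins n j p)) = card (above_pairs p) + (if mark p j then 1 else 0)"
proof -
  have "(hd p, n) \<notin> above_pairs p" using above_pairs_lt[OF assms(1), of "hd p" n] by blast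
  then show ?thesis using above_pairs_ins[OF assms] finite_above_pairs[of p] by simp
qed

text \<open>The marks are read off from the preceding insertion: after index 0 the head is the
  maximum and every nonzero index is marked; after any other index only 1 is.\<close>

lemma marks_sum:
  "(\<Sum>p\<in>Av (Suc n). \<Sum>j\<le>run p. if mark p j then h j else 0) =
    (\<Sum>p\<in>Av n. (\<Sum>j=1..Suc (run p). h j) + run p * h 1)"
  for h :: "nat \<Rightarrow> nat"
  unfolding sum_Av_Suc
proof (intro sum.cong refl)
  fix p assume p: "p \<in> Av n"
  let ?G = "\<lambda>q. \<Sum>j\<le>run q. if mark q j then h j else 0"
  have G0: "?G (ins n 0 p) = (\<Sum>j=1..Suc (run p). h j)"
  proof -
    have "mark (ins n 0 p) j \<longleftrightarrow> j \<noteq> 0" for j using Av_length[OF p] by (auto simp: mark_def ins_def)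
    moreover have "run (ins n 0 p) = Suc (run p)" using run_ins[OF Av_lt[OF p], of 0] by simp
    ultimately show ?thesis by (simp add: sum_atMost_split del: sum.atMost_Suc)
  qed
  have G1: "?G (ins n i p) = h 1" if "i \<in> {1..run p}" for i
  proof -
    have "i \<noteq> 0" "i \<le> length p" using that run_le_length[of p] by auto
    then have "hd (ins n i p) \<in> set p" by (cases p; cases i) (auto simp: ins_def)
    then have "hd (ins n i p) < n" using Av_lt[OF p] by blast
    moreover have "length (ins n i p) = Suc n" using Av_length[OF p] by (simp add: ins_def)
    ultimately have "mark (ins n i p) j \<longleftrightarrow> j = 1" for j by (auto simp: mark_def)
    moreover have "run (ins n i p) = i" using run_ins[OF Av_lt[OF p], of i] that by simp
    ultimately show ?thesis using that by (simp add: sum.delta)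
  qed
  show "(\<Sum>i\<le>run p. ?G (ins n i p)) = (\<Sum>j=1..Suc (run p). h j) + run p * h 1"
    using G0 G1 by (simp add: sum_atMost_split del: sum.atMost_Suc)
qed

lemma card_before_nth: "distinct xs \<Longrightarrow> i < length xs \<Longrightarrow> card {r. (r, xs ! i) \<in> before xs} = i"
proof -
  assume a: "distinct xs" "i < length xs"
  have "{r. (r, xs ! i) \<in> before xs} = set (take i xs)"
  proof (intro equalityI subsetI)
    fix r assume "r \<in> {r. (r, xs ! i) \<in> before xs}"
    then obtain k l where "k < l" "l < length xs" "xs ! k = r" "xs ! l = xs ! i"
      by (auto simp: before_iff_nth)
    then show "r \<in> set (take i xs)" using a by (auto simp: in_set_conv_nth nth_eq_iff_index_eq)
  next
    fix r assume "r \<in> set (take i xs)"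
    then obtain k where "k < i" "r = xs ! k" using a by (auto simp: in_set_conv_nth)
    then show "r \<in> {r. (r, xs ! i) \<in> before xs}" using a by (auto simp: before_nth_iff)
  qed
  then show ?thesis using a distinct_card[of "take i xs"] by simp
qed

text \<open>By \<open>above_before\<close> and \<open>greatest_after\<close>, the entries before \<open>a\<close> are exactly those exceeding \<open>b\<close>.\<close>
lemma both_pairs_notin_take:
  assumes p: "p \<in> Av n" and ab: "(a, b) \<in> both_pairs p" and j: "j \<le> run p"
  shows "a \<notin> set (take j p) \<longleftrightarrow> j \<le> n - 1 - b"
proof -
  have d: "distinct p" and sp: "set p = {..<n}" using p by (auto simp: Av_def)
  have ab': "(a, b) \<in> before p" "a < b" "above_before p a b" "greatest_after p a b" using ab by (auto simp: both_pairs_def above_pairs_def)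
  have "a \<in> set p" using before_set[OF ab'(1)] by simp
  then obtain i where i: "i < length p" "a = p ! i" by (auto simp: in_set_conv_nth)
  have "{r. (r, a) \<in> before p} = {b<..<n}"
  proof (intro equalityI subsetI)
    fix r assume "r \<in> {r. (r, a) \<in> before p}"
    then show "r \<in> {b<..<n}" using ab'(3) before_set[of r a p] sp by (auto simp: above_before_def)
  next
    fix r assume r: "r \<in> {b<..<n}"
    then have "r \<in> set p" "(a, r) \<notin> before p" "r \<noteq> a" using sp ab' by (auto simp: greatest_after_def)
    then show "r \<in> {r. (r, a) \<in> before p}" using before_total[OF \<open>a \<in> set p\<close>, of r] by auto
  qed
  then have "i = n - 1 - b" using card_before_nth[OF d i(1)] i(2) by simp
  moreover have "j \<le> length p" using j run_le_length[of p] by simp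
  then have "a \<notin> set (take j p) \<longleftrightarrow> j \<le> i"
    using i d by (auto simp: in_set_conv_nth nth_eq_iff_index_eq not_less[symmetric])
  ultimately show ?thesis by simp
qed

text \<open>
  Pairs are weighted by the number of ways to insert \<open>k\<close> further entries. A pair in \<open>both_pairs p\<close>
  survives an insertion only at an index \<open>j \<le> n - 1 - b\<close>; this bound grows by one with an
  insertion at index 0 and stops mattering after any other, hence the \<open>min\<close>.
\<close>
definition above_total :: "nat \<Rightarrow> nat \<Rightarrow> nat" where
  "above_total k n = (\<Sum>p\<in>Av n. card (above_pairs p) * ballot k (run p))"

definition both_total :: "nat \<Rightarrow> nat \<Rightarrow> nat" where
  "both_total k n = (\<Sum>p\<in>Av n. \<Sum>(a, b)\<in>both_pairs p. ballot k (min (n - 1 - b) (run p)))"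

definition marks :: "(nat \<Rightarrow> nat) \<Rightarrow> nat \<Rightarrow> nat" where
  "marks h n = (\<Sum>p\<in>Av n. \<Sum>j\<le>run p. if mark p j then h j else 0)"

lemma marks_0: "marks h 0 = 0"
  by (simp add: marks_def Av_0 mark_def)

text \<open>Old pairs survive every insertion, which turns their weight into
  \<open>ballot (Suc k)\<close>. A marked insertion adds one pair; as its index \<open>j\<close> is
  nonzero, the new run is \<open>j\<close> and the weight \<open>ballot k j\<close>.\<close>

lemma above_total_Suc: "above_total k (Suc n) = above_total (Suc k) n + marks (ballot k) n"
proof -
  have "(\<Sum>j\<le>run p. card (above_pairs (ins n j p)) * ballot k (run (ins n j p))) =
      card (above_pairs p) * ballot (Suc k) (run p) + (\<Sum>j\<le>run p. if mark p j then ballot k j else 0)"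
    if p: "p \<in> Av n" for p
  proof -
    have "(\<Sum>j\<le>run p. card (above_pairs (ins n j p)) * ballot k (run (ins n j p))) =
        (\<Sum>j\<le>run p. card (above_pairs p) * ballot k (run (ins n j p)) + (if mark p j then ballot k j else 0))"
    proof (intro sum.cong refl)
      fix j assume "j \<in> {..run p}"
      then have "card (above_pairs (ins n j p)) = card (above_pairs p) + (if mark p j then 1 else 0)"
        "mark p j \<Longrightarrow> run (ins n j p) = j"
        using card_above_pairs_ins[OF p] run_ins[OF Av_lt[OF p], of j] by (auto simp: mark_def)
      then show "card (above_pairs (ins n j p)) * ballot k (run (ins n j p)) =
          card (above_pairs p) * ballot k (run (ins n j p)) + (if mark p j then ballot k j else 0)"
        by simp
    qed
    then show ?thesis
      by (simp add: sum.distrib sum_distrib_left[symmetric] sum_ballot_ins[OF p] del: ballot.simps)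
  qed
  then show ?thesis by (simp add: above_total_def marks_def sum_Av_Suc sum.distrib del: ballot.simps)
qed

text \<open>A new pair has \<open>b = n\<close>, so its bound is 0 and its weight
  \<open>ballot k 0\<close>. An old pair survives exactly the indices up to its bound, and these
  again follow the steps of \<open>ballot\<close>.\<close>

lemma both_total_Suc: "both_total k (Suc n) = both_total (Suc k) n + marks (\<lambda>_. 1) n * catalan k"
proof -
  have "(\<Sum>j\<le>run p. \<Sum>(a, b)\<in>both_pairs (ins n j p). ballot k (min (Suc n - 1 - b) (run (ins n j p)))) =
      (\<Sum>(a, b)\<in>both_pairs p. ballot (Suc k) (min (n - 1 - b) (run p))) +
      (\<Sum>j\<le>run p. if mark p j then 1 else 0) * catalan k"
    if p: "p \<in> Av n" for p
  proof -
    have ltb: "b < n" if "(a, b) \<in> both_pairs p" for a b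
      using above_pairs_lt[OF p] that by (auto simp: both_pairs_def)
    have step: "(\<Sum>(a, b)\<in>both_pairs (ins n j p). ballot k (min (Suc n - 1 - b) (run (ins n j p)))) =
        (\<Sum>(a, b)\<in>both_pairs p. if j \<le> n - 1 - b then ballot k (min (n - b) (run (ins n j p))) else 0) +
        (if mark p j then 1 else 0) * catalan k" if j: "j \<le> run p" for j
    proof -
      let ?f = "\<lambda>(a, b). ballot k (min (n - b) (run (ins n j p)))"
      let ?O = "{(a, b). (a, b) \<in> both_pairs p \<and> a \<notin> set (take j p)}"
      have O: "?O = {x \<in> both_pairs p. j \<le> n - 1 - snd x}"
      proof (rule set_eqI)
        fix x show "x \<in> ?O \<longleftrightarrow> x \<in> {x \<in> both_pairs p. j \<le> n - 1 - snd x}"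
          using both_pairs_notin_take[OF p _ j, of "fst x" "snd x"]
          by (cases x; cases "x \<in> both_pairs p") simp_all
      qed
      have fin: "finite ?O" using finite_both_pairs[of p] by (rule rev_finite_subset) auto
      have "(hd p, n) \<notin> ?O" using ltb[of "hd p" n] by auto
      then have "sum ?f (both_pairs (ins n j p)) = sum ?f ?O + (if mark p j then catalan k else 0)"
        using fin unfolding both_pairs_ins[OF p j] by simp
      moreover have "sum ?f ?O = (\<Sum>(a, b)\<in>both_pairs p. if j \<le> n - 1 - b then ballot k (min (n - b) (run (ins n j p))) else 0)"
        unfolding O sum.inter_filter[OF finite_both_pairs] by (intro sum.cong) auto
      ultimately show ?thesis by simp
    qed
    have inner: "(\<Sum>j\<le>run p. if j \<le> n - 1 - b then ballot k (min (n - b) (run (ins n j p))) else 0) =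
        ballot (Suc k) (min (n - 1 - b) (run p))" if "(a, b) \<in> both_pairs p" for a b
    proof -
      let ?m = "min (n - 1 - b) (run p)"
      have "(\<Sum>j\<le>run p. if j \<le> n - 1 - b then ballot k (min (n - b) (run (ins n j p))) else 0) =
          (\<Sum>j\<le>?m. ballot k (min (n - b) (run (ins n j p))))"
        by (rule sum.mono_neutral_cong_right) auto
      \<comment> \<open>Index 0 raises both the bound and the run by one; a surviving
        \<open>j > 0\<close> makes the run equal to \<open>j\<close>, which is within the
        bound.\<close>
      also have "\<dots> = ballot k (Suc ?m) + (\<Sum>j=1..?m. ballot k j)"
      proof -
        have "min (n - b) (run (ins n 0 p)) = Suc ?m"
          using run_ins[OF Av_lt[OF p], of 0] ltb[OF that] by simp
        moreover have "min (n - b) (run (ins n j p)) = j" if "j \<in> {1..?m}" for j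
          using run_ins[OF Av_lt[OF p], of j] that by auto
        ultimately show ?thesis by (simp add: sum_atMost_split)
      qed
      also have "\<dots> = ballot (Suc k) ?m" by (simp add: ballot_Suc_sum del: ballot.simps)
      finally show ?thesis .
    qed
    have "(\<Sum>j\<le>run p. \<Sum>(a, b)\<in>both_pairs p. if j \<le> n - 1 - b then ballot k (min (n - b) (run (ins n j p))) else 0) =
        (\<Sum>(a, b)\<in>both_pairs p. ballot (Suc k) (min (n - 1 - b) (run p)))"
      unfolding case_prod_unfold
      by (subst sum.swap, intro sum.cong refl inner[of "fst x" "snd x" for x]) simp
    then show ?thesis using step by (simp add: sum.distrib sum_distrib_right del: ballot.simps)
  qed
  then show ?thesis
    unfolding both_total_def marks_def sum_Av_Suc
    by (simp add: sum.distrib sum_distrib_right del: ballot.simps)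
qed

section \<open>Solving the recursions along the generating tree\<close>

lemma marks_ballot:
  "int (marks (ballot k) (Suc n)) =
    int (catalan (Suc n + k)) + (int (catalan (Suc n)) - int (catalan n)) * int (catalan (Suc k))"
proof -
  \<comment> \<open>The sum over \<open>j\<close> is \<open>ballot (Suc k) (run p)\<close> by
    \<open>ballot_Suc_sum\<close>; below, \<open>ballot k 1\<close> is recognised as
    \<open>catalan (Suc k)\<close>.\<close>
  have "marks (ballot k) (Suc n) = (\<Sum>p\<in>Av n. ballot (Suc k) (run p) + run p * ballot k 1)"
    unfolding marks_def marks_sum ballot_Suc_sum ..
  also have "\<dots> = catalan (n + Suc k) + (\<Sum>p\<in>Av n. run p) * catalan (Suc k)"
    by (simp only: sum.distrib sum_ballot_run sum_distrib_right ballot.simps)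
  finally have "int (marks (ballot k) (Suc n)) =
      int (catalan (n + Suc k)) + int (\<Sum>p\<in>Av n. run p) * int (catalan (Suc k))"
    by (simp only: of_nat_add of_nat_mult)
  moreover have "int (\<Sum>p\<in>Av n. run p) = int (catalan (Suc n)) - int (catalan n)"
    using sum_run[of n] by linarith
  ultimately show ?thesis by (simp only: add_Suc_right add_Suc)
qed

lemma marks_one: "int (marks (\<lambda>_. 1) (Suc n)) = 2 * int (catalan (Suc n)) - int (catalan n)"
proof -
  have "marks (\<lambda>_. 1) (Suc n) = (\<Sum>p\<in>Av n. Suc (run p) + run p)"
    unfolding marks_def marks_sum by simp
  also have "\<dots> = 2 * (\<Sum>p\<in>Av n. run p) + catalan n"
    using card_Av[of n] by (simp add: sum.distrib sum_Suc)
  finally show ?thesis using sum_run[of n] by linarith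
qed

text \<open>Unrolling \<open>above_total_Suc\<close>: summand \<open>i\<close> is the contribution
  of \<open>marks\<close> at level \<open>Suc i\<close>, since level 0 has no marks.\<close>

lemma above_total_eq:
  "int (above_total k n) = (\<Sum>i<n - 1. int (catalan (n + k - 1)) +
    (int (catalan (Suc i)) - int (catalan i)) * int (catalan (n + k - 1 - i)))"
proof (induction n arbitrary: k)
  case 0
  then show ?case by (simp add: above_total_def Av_0 above_pairs_def)
next
  case (Suc n)
  show ?case
  proof (cases n)
    case 0
    then show ?thesis using Suc[of "Suc k"] by (simp add: above_total_Suc marks_0)
  next
    case (Suc l)
    have "n + Suc k - 1 = Suc n + k - 1" "Suc n - 1 = Suc (n - 1)" "Suc n + k - 1 - (n - 1) = Suc k"
      using Suc by auto
    then show ?thesis using Suc.IH[of "Suc k"] marks_ballot[of k l] Suc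
      by (simp add: above_total_Suc del: ballot.simps)
  qed
qed

lemma both_total_eq:
  "int (both_total k n) = (\<Sum>i<n - 1. (2 * int (catalan (Suc i)) - int (catalan i)) * int (catalan (n + k - 2 - i)))"
proof (induction n arbitrary: k)
  case 0
  then show ?case by (simp add: both_total_def Av_0 both_pairs_def above_pairs_def)
next
  case (Suc n)
  show ?case
  proof (cases n)
    case 0
    then show ?thesis using Suc[of "Suc k"] by (simp add: both_total_Suc marks_0)
  next
    case (Suc l)
    then show ?thesis using Suc.IH[of "Suc k"] marks_one[of l]
      by (simp add: both_total_Suc del: ballot.simps)
  qed
qed

text \<open>At \<open>k = 0\<close> all weights are 1, so the total counts pairs; what remains are
  truncated Catalan convolutions.\<close>

lemma sum_card_above_pairs:
  "int (\<Sum>p\<in>Av (Suc m). card (above_pairs p)) =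
    int (catalan (m + 2)) - 3 * int (catalan (m + 1)) + (int m + 1) * int (catalan m)"
proof -
  let ?c = "\<lambda>i. int (catalan i)"
  have "int (\<Sum>p\<in>Av (Suc m). card (above_pairs p)) = int (above_total 0 (Suc m))"
    by (simp add: above_total_def)
  also have "\<dots> = int m * ?c m + (\<Sum>i<m. ?c (Suc i) * ?c (m - i)) - (\<Sum>i<m. ?c i * ?c (m - i))"
    unfolding above_total_eq by (simp add: sum.distrib sum_subtractf algebra_simps del: ballot.simps)
  \<comment> \<open>The full convolution without its last term.\<close>
  also have "(\<Sum>i<m. ?c i * ?c (m - i)) = ?c (m + 1) - ?c m"
  proof -
    have "(\<Sum>i\<le>m. ?c i * ?c (m - i)) = ?c (Suc m)"
      using catalan_convolution[of m] by (simp flip: of_nat_mult of_nat_sum del: ballot.simps)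
    then show ?thesis by (simp add: lessThan_Suc_atMost[symmetric] del: ballot.simps(2,3))
  qed
  \<comment> \<open>The convolution of order \<open>Suc m\<close> without its first and last terms,
    both equal to \<open>?c (m + 1)\<close>.\<close>
  also have "(\<Sum>i<m. ?c (Suc i) * ?c (m - i)) = ?c (m + 2) - 2 * ?c (m + 1)"
  proof -
    have "(\<Sum>i\<le>Suc m. ?c i * ?c (Suc m - i)) = ?c (Suc (Suc m))"
      using catalan_convolution[of "Suc m"] by (simp flip: of_nat_mult of_nat_sum del: ballot.simps sum.atMost_Suc)
    moreover have "(\<Sum>i\<le>Suc m. ?c i * ?c (Suc m - i)) = ?c (Suc m) + (\<Sum>i\<le>m. ?c (Suc i) * ?c (m - i))"
      by (simp add: sum.atMost_Suc_shift del: ballot.simps(2,3) sum.atMost_Suc)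
    moreover have "(\<Sum>i\<le>m. ?c (Suc i) * ?c (m - i)) = (\<Sum>i<m. ?c (Suc i) * ?c (m - i)) + ?c (Suc m)"
      by (simp add: lessThan_Suc_atMost[symmetric] del: ballot.simps(2,3))
    ultimately show ?thesis by (simp del: ballot.simps)
  qed
  finally show ?thesis by (simp add: algebra_simps del: ballot.simps)
qed

lemma sum_card_both_pairs:
  "int (\<Sum>p\<in>Av (Suc (Suc l)). card (both_pairs p)) = 2 * int (catalan (l + 2)) - 3 * int (catalan (l + 1))"
proof -
  let ?c = "\<lambda>i. int (catalan i)"
  have conv: "(\<Sum>i\<le>m. ?c i * ?c (m - i)) = ?c (Suc m)" for m
    using catalan_convolution[of m] by (simp flip: of_nat_mult of_nat_sum del: ballot.simps)
  have "int (\<Sum>p\<in>Av (Suc (Suc l)). card (both_pairs p)) = int (both_total 0 (Suc (Suc l)))"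
    by (simp add: both_total_def)
  also have "\<dots> = 2 * (\<Sum>i\<le>l. ?c (Suc i) * ?c (l - i)) - (\<Sum>i\<le>l. ?c i * ?c (l - i))"
    unfolding both_total_eq
    by (simp add: lessThan_Suc_atMost sum_subtractf sum_distrib_left algebra_simps del: ballot.simps sum.lessThan_Suc)
  \<comment> \<open>Here only the first term of the convolution of order \<open>Suc l\<close> is
    missing.\<close>
  also have "(\<Sum>i\<le>l. ?c (Suc i) * ?c (l - i)) = ?c (l + 2) - ?c (l + 1)"
  proof -
    have "(\<Sum>i\<le>Suc l. ?c i * ?c (Suc l - i)) = ?c (Suc l) + (\<Sum>i\<le>l. ?c (Suc i) * ?c (l - i))"
      by (simp add: sum.atMost_Suc_shift del: ballot.simps(2,3) sum.atMost_Suc)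
    then show ?thesis using conv[of "Suc l"] by (simp del: ballot.simps sum.atMost_Suc)
  qed
  finally show ?thesis using conv[of l] by (simp del: ballot.simps)
qed

subsection \<open>A symmetry of 123-avoiding permutations\<close>

text \<open>On a distinct list this is the position of \<open>c\<close> counted from the end,
  starting at 0.\<close>

definition after :: "nat list \<Rightarrow> nat \<Rightarrow> nat" where
  "after xs c = card {r. (c, r) \<in> before xs}"

text \<open>The rotated inverse: positions and values are exchanged and both orders reversed.\<close>
definition dual :: "nat list \<Rightarrow> nat list" where
  "dual xs = rev (map (after xs) [0..<length xs])"

lemma after_nth: "distinct xs \<Longrightarrow> i < length xs \<Longrightarrow> after xs (xs ! i) = length xs - Suc i"
proof -
  assume a: "distinct xs" "i < length xs"
  have "{r. (xs ! i, r) \<in> before xs} = (!) xs ` {Suc i..<length xs}"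
  proof (intro equalityI subsetI)
    fix r assume "r \<in> {r. (xs ! i, r) \<in> before xs}"
    then obtain k l where "k < l" "l < length xs" "xs ! k = xs ! i" "xs ! l = r"
      by (auto simp: before_iff_nth)
    then show "r \<in> (!) xs ` {Suc i..<length xs}" using a by (auto simp: nth_eq_iff_index_eq)
  next
    fix r assume "r \<in> (!) xs ` {Suc i..<length xs}"
    then show "r \<in> {r. (xs ! i, r) \<in> before xs}" using a by (auto simp: before_nth_iff)
  qed
  moreover have "inj_on ((!) xs) {Suc i..<length xs}"
    using a by (auto simp: inj_on_def nth_eq_iff_index_eq)
  ultimately show ?thesis by (simp add: after_def card_image)
qed

context
  fixes p :: "nat list" and n :: nat
  assumes p: "distinct p" "set p = {..<n}"
begin

lemma perm_length: "length p = n"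
  using p distinct_card[of p] by simp

lemma after_lt: "c < n \<Longrightarrow> after p c < n"
proof -
  assume "c < n"
  then obtain i where "i < n" "c = p ! i" using p perm_length by (metis in_set_conv_nth lessThan_iff)
  then show ?thesis using after_nth[of p i] p perm_length by simp
qed

lemma after_less_iff: "c < n \<Longrightarrow> d < n \<Longrightarrow> after p c < after p d \<longleftrightarrow> (d, c) \<in> before p"
proof -
  assume "c < n" "d < n"
  then obtain i j where ij: "i < n" "c = p ! i" "j < n" "d = p ! j"
    using p perm_length by (metis in_set_conv_nth lessThan_iff)
  then have "after p c = n - Suc i" "after p d = n - Suc j" "(d, c) \<in> before p \<longleftrightarrow> j < i"
    using after_nth[OF p(1)] before_nth_iff[OF p(1)] perm_length by simp_all
  then show ?thesis using ij(1,3) by (simp add: less_diff_conv2 diff_less_mono2) linarith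
qed

lemma inj_after: "inj_on (after p) {..<n}"
proof (rule inj_onI)
  fix c d assume cd: "c \<in> {..<n}" "d \<in> {..<n}" "after p c = after p d"
  then show "c = d" using after_less_iff[of c d] after_less_iff[of d c] before_total[of c p d] p by auto
qed

lemma after_image: "after p ` {..<n} = {..<n}"
  by (rule endo_inj_surj[OF finite_lessThan _ inj_after]) (simp add: image_subset_iff after_lt)

lemma dual_nth: "i < n \<Longrightarrow> dual p ! i = after p (n - Suc i)"
  by (simp add: dual_def perm_length rev_nth)

lemma dual_perm: "distinct (dual p)" "set (dual p) = {..<n}" "length (dual p) = n"
  using inj_after after_image by (auto simp: dual_def perm_length distinct_map lessThan_atLeast0)

text \<open>The value \<open>after p c\<close> stands at place \<open>n - Suc c\<close> of the dual.
  Together with \<open>after_less_iff\<close> this lets "smaller" and "later" trade roles.\<close>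

lemma before_dual: "c < n \<Longrightarrow> d < n \<Longrightarrow> (after p c, after p d) \<in> before (dual p) \<longleftrightarrow> d < c"
proof -
  assume cd: "c < n" "d < n"
  have "dual p ! (n - Suc c) = after p c" "dual p ! (n - Suc d) = after p d"
    using cd by (auto simp: dual_nth)
  moreover have "n - Suc c < n" "n - Suc d < n" "n - Suc c < n - Suc d \<longleftrightarrow> d < c" using cd by auto
  ultimately show ?thesis
    using before_nth_iff[of "dual p" "n - Suc c" "n - Suc d"] dual_perm(1,3) by simp
qed

lemma after_dual: "c < n \<Longrightarrow> after (dual p) (after p c) = c"
proof -
  assume c: "c < n"
  then have "after p c = dual p ! (n - Suc c)" by (simp add: dual_nth)
  then show ?thesis using after_nth[of "dual p" "n - Suc c"] dual_perm c by simp
qed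

lemma dual_dual: "dual (dual p) = p"
proof (rule nth_equalityI)
  show "length (dual (dual p)) = length p" by (simp add: dual_def)
next
  fix i assume "i < length (dual (dual p))"
  then have i: "i < n" by (simp add: dual_def perm_length)
  have "p ! i < n" using i p perm_length nth_mem by fastforce
  have "dual (dual p) ! i = after (dual p) (n - Suc i)"
    using i dual_perm by (simp add: dual_def[of "dual p"] rev_nth)
  also have "n - Suc i = after p (p ! i)" using after_nth[of p i] p i perm_length by simp
  also have "after (dual p) (after p (p ! i)) = p ! i" by (rule after_dual) fact
  finally show "dual (dual p) ! i = p ! i" .
qed

text \<open>Every entry of the dual has the form \<open>after p r\<close>, so conditions on its
  order of occurrence become conditions on the values of \<open>p\<close>.\<close>

lemma ball_before_dual:
  "(\<forall>r. (r, after p c) \<in> before (dual p) \<longrightarrow> P r) \<longleftrightarrow> (\<forall>r<n. c < r \<longrightarrow> P (after p r))"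
  "(\<forall>r. (after p c, r) \<in> before (dual p) \<longrightarrow> P r) \<longleftrightarrow> (\<forall>r<n. r < c \<longrightarrow> P (after p r))"
  if "c < n"
proof -
  have ex: "\<exists>s<n. r = after p s" if "(r, y) \<in> before (dual p) \<or> (y, r) \<in> before (dual p)" for r y
  proof -
    have "r \<in> after p ` {..<n}"
      using that before_set[of r y "dual p"] before_set[of y r "dual p"] unfolding dual_perm(2) after_image by blast
    then show ?thesis by auto
  qed
  show "(\<forall>r. (r, after p c) \<in> before (dual p) \<longrightarrow> P r) \<longleftrightarrow> (\<forall>r<n. c < r \<longrightarrow> P (after p r))"
    using before_dual[OF _ that] ex by blast
  show "(\<forall>r. (after p c, r) \<in> before (dual p) \<longrightarrow> P r) \<longleftrightarrow> (\<forall>r<n. r < c \<longrightarrow> P (after p r))"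
    using before_dual[OF that] ex by blast
qed

lemma avoids123_dual: "avoids123 p \<Longrightarrow> avoids123 (dual p)"
  unfolding avoids123_def[of "dual p"]
proof (intro allI impI notI)
  assume av: "avoids123 p"
  fix x y z assume h: "(x, y) \<in> before (dual p)" "(y, z) \<in> before (dual p)" "x < y" "y < z"
  then have "x \<in> after p ` {..<n}" "y \<in> after p ` {..<n}" "z \<in> after p ` {..<n}"
    using before_set[OF h(1)] before_set[OF h(2)] unfolding dual_perm(2) after_image by blast+
  then obtain a b c where abc: "x = after p a" "y = after p b" "z = after p c" "a < n" "b < n" "c < n"
    by auto
  have "b < a" "c < b" "(b, a) \<in> before p" "(c, b) \<in> before p"
    using h unfolding abc(1-3) before_dual[OF abc(4,5)] before_dual[OF abc(5,6)]
      after_less_iff[OF abc(4,5)] after_less_iff[OF abc(5,6)] by simp_all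
  then show False using av unfolding avoids123_def by blast
qed

text \<open>The pair \<open>(a, b)\<close> corresponds to \<open>(after p b, after p a)\<close>. The
  first factor of \<open>avoids123_swap_iff\<close> is preserved with its alternatives exchanged,
  and the alternatives of the second are exchanged too, which carries \<open>above_pairs\<close> to
  \<open>greatest_pairs\<close>.\<close>

lemma before_after_conditions_dual:
  assumes ab: "a < b" "(a, b) \<in> before p"
  shows "least_before (dual p) (after p b) (after p a) \<longleftrightarrow> below_after p a b"
    "below_after (dual p) (after p b) (after p a) \<longleftrightarrow> least_before p a b"
    "above_before (dual p) (after p b) (after p a) \<longleftrightarrow> greatest_after p a b"
    "greatest_after (dual p) (after p b) (after p a) \<longleftrightarrow> above_before p a b"
proof -
  have lt: "r < n" if "(r, y) \<in> before p \<or> (y, r) \<in> before p" for r y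
    using that before_set[of r y p] before_set[of y r p] p by auto
  have an: "a < n" "b < n" using ab(2) lt by blast+
  have tot: "(r, s) \<in> before p \<longleftrightarrow> (s, r) \<notin> before p" if "r < n" "s < n" "r \<noteq> s" for r s
    using that before_total[of r p s] before_asym[of p r s] p by auto
  have le: "after p c \<le> after p d \<longleftrightarrow> (c, d) \<notin> before p" if "c < n" "d < n" for c d
    using after_less_iff[OF that(2,1)] by (simp add: not_less[symmetric])
  have "(\<forall>r<n. a < r \<longrightarrow> after p b \<le> after p r) \<longleftrightarrow> (\<forall>r<n. (b, r) \<in> before p \<longrightarrow> r < a)"
    using le[OF an(2)] tot[OF an] ab by (metis linorder_neqE_nat less_asym)
  then show "least_before (dual p) (after p b) (after p a) \<longleftrightarrow> below_after p a b"
    unfolding least_before_def below_after_def ball_before_dual[OF an(1)] using lt by blast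
  have "(\<forall>r<n. r < a \<longrightarrow> after p r < after p b) \<longleftrightarrow> (\<forall>r<n. (r, b) \<in> before p \<longrightarrow> a \<le> r)"
    using after_less_iff[OF _ an(2)] tot[OF _ an(2)] ab by (metis less_asym not_less)
  then show "below_after (dual p) (after p b) (after p a) \<longleftrightarrow> least_before p a b"
    unfolding least_before_def below_after_def ball_before_dual[OF an(1)] using lt by blast
  have "(\<forall>r<n. b < r \<longrightarrow> after p a < after p r) \<longleftrightarrow> (\<forall>r<n. (a, r) \<in> before p \<longrightarrow> r \<le> b)"
    using after_less_iff[OF an(1)] tot[OF an(1)] ab by (metis less_asym not_less)
  then show "above_before (dual p) (after p b) (after p a) \<longleftrightarrow> greatest_after p a b"
    unfolding above_before_def greatest_after_def ball_before_dual[OF an(2)] using lt by blast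
  have "(\<forall>r<n. r < b \<longrightarrow> after p r \<le> after p a) \<longleftrightarrow> (\<forall>r<n. (r, a) \<in> before p \<longrightarrow> b < r)"
    using le[OF _ an(1)] tot[OF an] ab by (metis linorder_neqE_nat less_asym)
  then show "greatest_after (dual p) (after p b) (after p a) \<longleftrightarrow> above_before p a b"
    unfolding above_before_def greatest_after_def ball_before_dual[OF an(2)] using lt by blast
qed

end

definition greatest_pairs :: "nat list \<Rightarrow> (nat \<times> nat) set" where
  "greatest_pairs xs = {(a, b). a < b \<and> (a, b) \<in> before xs \<and> greatest_after xs a b \<and> (least_before xs a b \<or> below_after xs a b)}"

lemma dual_Av: "p \<in> Av n \<Longrightarrow> dual p \<in> Av n"
  using dual_perm[of p n] avoids123_dual[of p n] by (simp add: Av_def)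

lemma card_greatest_pairs_dual:
  assumes "p \<in> Av n"
  shows "card (greatest_pairs (dual p)) = card (above_pairs p)"
proof -
  have p: "distinct p" "set p = {..<n}" using assms by (auto simp: Av_def)
  note q = dual_perm[OF p]
  have "bij_betw (\<lambda>(a, b). (after p b, after p a)) (above_pairs p) (greatest_pairs (dual p))"
  proof (rule bij_betw_byWitness[where f' = "\<lambda>(a, b). (after (dual p) b, after (dual p) a)"])
    have lt: "a < n \<and> b < n" if "(a, b) \<in> above_pairs p" for a b
      using that before_set[of a b p] p by (auto simp: above_pairs_def)
    have lt': "a < n \<and> b < n" if "(a, b) \<in> greatest_pairs (dual p)" for a b
      using that before_set[of a b "dual p"] q by (auto simp: greatest_pairs_def)
    show "\<forall>x\<in>above_pairs p. (case case x of (a, b) \<Rightarrow> (after p b, after p a) of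
        (a, b) \<Rightarrow> (after (dual p) b, after (dual p) a)) = x"
      using lt after_dual[OF p] by auto
    show "\<forall>x\<in>greatest_pairs (dual p). (case case x of (a, b) \<Rightarrow> (after (dual p) b, after (dual p) a) of
        (a, b) \<Rightarrow> (after p b, after p a)) = x"
      using lt' after_dual[OF q(1,2)] dual_dual[OF p] by auto
    show "(\<lambda>(a, b). (after p b, after p a)) ` above_pairs p \<subseteq> greatest_pairs (dual p)"
    proof clarify
      fix a b assume ab: "(a, b) \<in> above_pairs p"
      then show "(after p b, after p a) \<in> greatest_pairs (dual p)"
        using lt[OF ab] before_dual[OF p, of b a] after_less_iff[OF p, of b a] before_after_conditions_dual[OF p, of a b] ab
        by (auto simp: above_pairs_def greatest_pairs_def)
    qed
    show "(\<lambda>(a, b). (after (dual p) b, after (dual p) a)) ` greatest_pairs (dual p) \<subseteq> above_pairs p"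
    proof clarify
      fix a b assume ab: "(a, b) \<in> greatest_pairs (dual p)"
      then show "(after (dual p) b, after (dual p) a) \<in> above_pairs p"
        using lt'[OF ab] before_dual[OF q(1,2), of b a] after_less_iff[OF q(1,2), of b a]
          before_after_conditions_dual[OF q(1,2), of a b] dual_dual[OF p]
        by (auto simp: above_pairs_def greatest_pairs_def)
    qed
  qed
  then show ?thesis by (rule bij_betw_same_card[symmetric])
qed

lemma sum_card_greatest_pairs: "(\<Sum>p\<in>Av n. card (greatest_pairs p)) = (\<Sum>p\<in>Av n. card (above_pairs p))"
proof -
  have r: "dual (dual p) = p" if "p \<in> Av n" for p
    using that dual_dual[of p n] by (simp add: Av_def)
  have "bij_betw dual (Av n) (Av n)"
    by (rule bij_betw_byWitness[where f' = dual]) (auto simp: r dual_Av)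
  then have "(\<Sum>p\<in>Av n. card (greatest_pairs p)) = (\<Sum>p\<in>Av n. card (greatest_pairs (dual p)))"
    by (rule sum.reindex_bij_betw[symmetric])
  then show ?thesis by (simp add: card_greatest_pairs_dual)
qed

subsection \<open>Words with at most one coincidence\<close>

text \<open>Each unordered pair of 123-avoiding permutations differing by a transposition is
  recorded once, by the member in which the smaller value comes first.\<close>

definition swap_triples :: "nat \<Rightarrow> (nat list \<times> nat \<times> nat) set" where
  "swap_triples n = (SIGMA p:Av n. swaps p)"

lemma finite_swaps: "finite (swaps p)"
  by (rule finite_subset[of _ "set p \<times> set p"]) (auto simp: swaps_def dest: before_set)

lemma finite_swap_triples: "finite (swap_triples n)"
  by (simp add: swap_triples_def finite_Av finite_swaps)

lemma swaps_lt: "p \<in> Av n \<Longrightarrow> (a, b) \<in> swaps p \<Longrightarrow> a < b \<and> b < n"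
  by (auto simp: swaps_def Av_def dest: before_set)

definition coincidences :: "nat \<Rightarrow> nat list \<Rightarrow> (nat list \<times> nat \<times> nat) set" where
  "coincidences n u = {(p, a, b) \<in> swap_triples n. u ! a = u ! b}"

text \<open>The fibres of \<open>p \<mapsto> map ((!) u) p\<close> on \<open>Av n\<close> have one
  element or consist of \<open>p\<close> and its transposed copy. The set \<open>?D\<close> contains
  exactly one member of each fibre of the second kind, so removing it leaves one representative per
  image.\<close>

lemma card_image_one_coincidence:
  assumes ab: "a < b" "b < n" "u ! a = u ! b"
    and unique: "\<And>c d. c < n \<Longrightarrow> d < n \<Longrightarrow> u ! c = u ! d \<Longrightarrow> c = d \<or> {c, d} = {a, b}"
  shows "card ((\<lambda>p. map ((!) u) p) ` Av n) + card {p \<in> Av n. (a, b) \<in> swaps p} = card (Av n)"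
proof -
  let ?t = "transpose a b" and ?F = "\<lambda>p. map ((!) u) p"
  let ?D = "{p \<in> Av n. (a, b) \<in> swaps p}"
  have inv: "map ?t (map ?t p) = p" for p by (simp add: o_def)
  have F: "?F (map ?t p) = ?F p" for p using ab(3) by (auto simp: transpose_def)
  \<comment> \<open>Where \<open>p\<close> and \<open>q\<close> differ, they carry \<open>a\<close>
    and \<open>b\<close> in opposite order; distinctness then forces a difference at the other place
    holding one of the two values.\<close>
  have two: "q = p \<or> q = map ?t p" if p: "p \<in> Av n" and q: "q \<in> Av n" and e: "?F p = ?F q" for p q
  proof (rule disjCI)
    assume "q \<noteq> map ?t p"
    have l: "length p = n" "length q = n" "distinct p" "distinct q" "set p = {..<n}" "set q = {..<n}"
      using p q Av_length by (auto simp: Av_def)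
    have lt: "p ! i < n" "q ! i < n" if "i < n" for i using l that nth_mem by fastforce+
    have alt: "p ! i = q ! i \<or> {p ! i, q ! i} = {a, b}" if "i < n" for i
      using unique[OF lt[OF that]] arg_cong[OF e, of "\<lambda>l. l ! i"] that l by simp
    have "q ! i = p ! i" if i: "i < n" for i
    proof (rule ccontr)
      assume ne: "q ! i \<noteq> p ! i"
      then have pi: "{p ! i, q ! i} = {a, b}" using alt[OF i] by auto
      have "q ! j = ?t (p ! j)" if j: "j < n" for j
      proof (cases "p ! j \<in> {a, b}")
        case True
        then consider "j = i" | "j \<noteq> i" "p ! j = q ! i"
          using pi l i j by (metis (no_types, lifting) doubleton_eq_iff insertE nth_eq_iff_index_eq singletonD)
        then have "q ! j \<noteq> p ! j"
          using ne l i j by cases (auto simp: nth_eq_iff_index_eq)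
        then have "{p ! j, q ! j} = {a, b}" "p ! j \<noteq> q ! j" using alt[OF j] by auto
        then show ?thesis by (auto simp: doubleton_eq_iff)
      next
        case False
        then have "p ! j = q ! j" using alt[OF j] by blast
        then show ?thesis using False by auto
      qed
      then have "q = map ?t p" using l by (intro nth_equalityI) auto
      then show False using \<open>q \<noteq> map ?t p\<close> by simp
    qed
    then show "q = p" using l by (intro nth_equalityI) auto
  qed
  have D: "map ?t p \<in> Av n - ?D" if p: "p \<in> ?D" for p
  proof -
    have p': "p \<in> Av n" "(a, b) \<in> before p" "avoids123 (map ?t p)" using p by (auto simp: swaps_def)
    have "?t ` {..<n} = {..<n}" using ab by (intro transpose_image_eq) auto
    then have "map ?t p \<in> Av n"
      using p' by (auto simp: Av_def distinct_map)
    moreover have "(a, b) \<notin> before (map ?t p)"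
      using p' before_asym[of p a b] by (simp add: before_map_transpose Av_def)
    ultimately show ?thesis by (simp add: swaps_def)
  qed
  have "?F ` Av n = ?F ` (Av n - ?D)"
  proof
    show "?F ` Av n \<subseteq> ?F ` (Av n - ?D)"
    proof
      fix w assume "w \<in> ?F ` Av n"
      then obtain p where p: "p \<in> Av n" "w = ?F p" by auto
      show "w \<in> ?F ` (Av n - ?D)"
      proof (cases "p \<in> ?D")
        case True
        then show ?thesis using D[OF True] p(2) F[of p] by (intro image_eqI[of _ _ "map ?t p"]) simp_all
      qed (use p in auto)
    qed
  qed auto
  moreover have "inj_on ?F (Av n - ?D)"
  proof (rule inj_onI, rule ccontr)
    fix p q assume pq: "p \<in> Av n - ?D" "q \<in> Av n - ?D" "?F p = ?F q" "p \<noteq> q"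
    then have q: "q = map ?t p" using two[of p q] by auto
    then have p: "p = map ?t q" using inv by simp
    have s: "avoids123 p" "avoids123 q" "set p = {..<n}" using pq by (auto simp: Av_def)
    consider "(a, b) \<in> before p" | "(b, a) \<in> before p" using before_total[of a p b] s ab by auto
    then show False
    proof cases
      case 1
      then have "(a, b) \<in> swaps p" using s q ab by (auto simp: swaps_def)
      then show False using pq by auto
    next
      case 2
      then have "(a, b) \<in> before q" using q by (simp add: before_map_transpose)
      then have "(a, b) \<in> swaps q" using s(1) ab(1) unfolding p swaps_def by auto
      then show False using pq by auto
    qed
  qed
  ultimately have "card (?F ` Av n) = card (Av n - ?D)" by (simp add: card_image)
  also have "\<dots> = card (Av n) - card ?D" by (rule card_Diff_subset) (auto simp: finite_Av)
  finally show ?thesis using card_mono[of "Av n" ?D] finite_Av[of n] by auto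
qed

text \<open>With at least \<open>n - 1\<close> letters, \<open>u\<close> is either distinct, and
  then nothing is identified, or has exactly one pair of equal places, and then the preceding count
  applies.\<close>

lemma card_image_few_coincidences:
  assumes l: "length u = n" and c: "n \<le> Suc (card (set u))"
  shows "card ((\<lambda>p. map ((!) u) p) ` Av n) + card (coincidences n u) = card (Av n)"
proof (cases "distinct u")
  case True
  have "inj_on (\<lambda>p. map ((!) u) p) (Av n)"
  proof (rule inj_onI)
    fix p q assume "p \<in> Av n" "q \<in> Av n" "map ((!) u) p = map ((!) u) q"
    moreover have "inj_on ((!) u) {..<n}" using True l by (auto simp: inj_on_def nth_eq_iff_index_eq)
    ultimately show "p = q" using map_inj_on[of "(!) u" p q] by (simp add: Av_def)
  qed
  moreover have "coincidences n u = {}"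
    using True l swaps_lt by (fastforce simp: coincidences_def swap_triples_def nth_eq_iff_index_eq)
  ultimately show ?thesis by (simp add: card_image)
next
  case False
  then obtain a b where ab: "a < b" "b < n" "u ! a = u ! b"
    using l unfolding distinct_conv_nth by (metis linorder_neqE_nat)
  have "(!) u ` ({..<n} - {b}) = set u"
  proof -
    have "set u = (!) u ` {..<n}" using l by (auto simp: set_conv_nth)
    also have "\<dots> = (!) u ` ({..<n} - {b})"
    proof
      show "(!) u ` {..<n} \<subseteq> (!) u ` ({..<n} - {b})"
      proof
        fix x assume "x \<in> (!) u ` {..<n}"
        then obtain i where i: "i < n" "x = u ! i" by auto
        show "x \<in> (!) u ` ({..<n} - {b})"
          by (rule image_eqI[of _ _ "if i = b then a else i"]) (use i ab in auto)
      qed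
    qed auto
    finally show ?thesis by simp
  qed
  \<comment> \<open>Place \<open>b\<close> repeats the letter of \<open>a\<close>, so the other
    \<open>n - 1\<close> places carry all the letters and hence no repetition.\<close>
  then have "card ({..<n} - {b}) \<le> card ((!) u ` ({..<n} - {b}))" using c ab by simp
  then have inj: "inj_on ((!) u) ({..<n} - {b})"
    by (intro eq_card_imp_inj_on) (auto intro: antisym card_image_le)
  have unique: "x = y \<or> {x, y} = {a, b}" if xy: "x < n" "y < n" "u ! x = u ! y" for x y
  proof -
    have "y = a" if "x = b" "y \<noteq> b" using inj_onD[OF inj, of y a] that xy ab by simp
    moreover have "x = a" if "y = b" "x \<noteq> b" using inj_onD[OF inj, of x a] that xy ab by simp
    moreover have "x = y" if "x \<noteq> b" "y \<noteq> b" using inj_onD[OF inj, of x y] that xy by simp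
    ultimately show ?thesis by (cases "x = b"; cases "y = b") auto
  qed
  have "coincidences n u = (\<lambda>p. (p, a, b)) ` {p \<in> Av n. (a, b) \<in> swaps p}"
  proof (intro equalityI subsetI)
    fix x assume "x \<in> coincidences n u"
    then obtain p a' b' where x: "x = (p, a', b')" "p \<in> Av n" "(a', b') \<in> swaps p" "u ! a' = u ! b'"
      by (auto simp: coincidences_def swap_triples_def)
    then have "a' = a \<and> b' = b"
      using swaps_lt[OF x(2,3)] unique[of a' b'] ab by (auto simp: doubleton_eq_iff)
    then show "x \<in> (\<lambda>p. (p, a, b)) ` {p \<in> Av n. (a, b) \<in> swaps p}" using x by auto
  next
    fix x assume "x \<in> (\<lambda>p. (p, a, b)) ` {p \<in> Av n. (a, b) \<in> swaps p}"
    then show "x \<in> coincidences n u" using ab by (auto simp: coincidences_def swap_triples_def)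
  qed
  then have "card (coincidences n u) = card {p \<in> Av n. (a, b) \<in> swaps p}"
    by (simp add: card_image inj_on_def)
  then show ?thesis using card_image_one_coincidence[OF ab unique] by linarith
qed

section \<open>Counting words with coincidences and bounding the error\<close>

lemma card_words_coincidence:
  assumes ab: "a < b" "b < n"
  shows "card {u \<in> words k n. u ! a = u ! b} = k ^ (n - 1)"
proof -
  \<comment> \<open>Delete the letter at \<open>b\<close>; it is restored as a copy of the letter at
    \<open>a\<close>, whose index is unaffected since \<open>a < b\<close>.\<close>
  let ?f = "\<lambda>u. take b u @ drop (Suc b) u" and ?g = "\<lambda>v. take b v @ v ! a # drop b v"
  have "bij_betw ?f {u \<in> words k n. u ! a = u ! b} (words k (n - 1))"
  proof (rule bij_betw_byWitness[where f' = ?g])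
    show "\<forall>u\<in>{u \<in> words k n. u ! a = u ! b}. ?g (?f u) = u"
    proof
      fix u assume "u \<in> {u \<in> words k n. u ! a = u ! b}"
      then have u: "length u = n" "u ! a = u ! b" by (auto simp: words_def)
      have "?g (?f u) = take b u @ u ! b # drop (Suc b) u"
        using u ab by (simp add: nth_append)
      then show "?g (?f u) = u" using id_take_nth_drop[of b u] u ab by simp
    qed
    show "\<forall>v\<in>words k (n - 1). ?f (?g v) = v"
    proof
      fix v :: "nat list" assume "v \<in> words k (n - 1)"
      then have "length v = n - 1" by (simp add: words_def)
      then have "b \<le> length v" using ab by simp
      then show "?f (?g v) = v" by simp
    qed
    show "?f ` {u \<in> words k n. u ! a = u ! b} \<subseteq> words k (n - 1)"
      using ab set_take_subset set_drop_subset by (fastforce simp: words_def)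
    show "?g ` words k (n - 1) \<subseteq> {u \<in> words k n. u ! a = u ! b}"
    proof
      fix u assume "u \<in> ?g ` words k (n - 1)"
      then obtain v where v: "u = ?g v" "length v = n - 1" "set v \<subseteq> {0..<k}" by (auto simp: words_def)
      then have b: "b \<le> length v" "a < length v" using ab by auto
      have "v ! a \<in> set v" using b by simp
      then have "set u \<subseteq> {0..<k}" using v set_take_subset[of b v] set_drop_subset[of b v] by auto
      moreover have "length u = n" "u ! a = u ! b" using v b ab by (auto simp: nth_append)
      ultimately show "u \<in> {u \<in> words k n. u ! a = u ! b}" by (simp add: words_def)
    qed
  qed
  from bij_betw_same_card[OF this] show ?thesis by (simp add: card_words)
qed

lemma sum_card_coincidences:
  "(\<Sum>u\<in>words k n. card (coincidences n u)) = card (swap_triples n) * k ^ (n - 1)"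
proof -
  have "(\<Sum>u\<in>words k n. card (coincidences n u)) =
      (\<Sum>u\<in>words k n. \<Sum>x\<in>swap_triples n. if u ! fst (snd x) = u ! snd (snd x) then 1 else 0)"
  proof (rule sum.cong[OF refl])
    fix u
    have "coincidences n u = {x \<in> swap_triples n. u ! fst (snd x) = u ! snd (snd x)}"
      by (auto simp: coincidences_def)
    then show "card (coincidences n u) =
        (\<Sum>x\<in>swap_triples n. if u ! fst (snd x) = u ! snd (snd x) then 1 else 0)"
      by (simp add: sum.inter_filter[OF finite_swap_triples, symmetric])
  qed
  also have "\<dots> = (\<Sum>x\<in>swap_triples n. card {u \<in> words k n. u ! fst (snd x) = u ! snd (snd x)})"
    by (subst sum.swap) (simp add: sum.inter_filter[OF finite_words, symmetric])
  also have "\<dots> = (\<Sum>x\<in>swap_triples n. k ^ (n - 1))"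
    by (intro sum.cong refl card_words_coincidence) (auto simp: swap_triples_def dest: swaps_lt)
  finally show ?thesis by simp
qed

text \<open>Such a word is coded by a list of \<open>m\<close> letters containing all of its own,
  together with a word of \<open>n\<close> indices into that list.\<close>

lemma card_words_few_letters:
  assumes "k \<ge> 1"
  shows "card {u \<in> words k n. card (set u) \<le> m} \<le> m ^ n * k ^ m"
proof -
  have "{u \<in> words k n. card (set u) \<le> m} \<subseteq> (\<lambda>(v, f). map ((!) v) f) ` (words k m \<times> words m n)"
  proof
    fix u assume "u \<in> {u \<in> words k n. card (set u) \<le> m}"
    then have u: "length u = n" "set u \<subseteq> {0..<k}" "card (set u) \<le> m" by (auto simp: words_def)
    define l where "l = sorted_list_of_set (set u)"
    \<comment> \<open>Padding to length \<open>m\<close> with 0, which is a letter because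
      \<open>k \<ge> 1\<close>.\<close>
    define v where "v = l @ replicate (m - card (set u)) 0"
    have l: "set l = set u" "length l = card (set u)" by (simp_all add: l_def)
    have "v \<in> words k m" using l u assms by (auto simp: v_def words_def)
    moreover have "\<forall>x\<in>set u. \<exists>i<m. v ! i = x"
    proof
      fix x assume "x \<in> set u"
      then obtain i where "i < length l" "l ! i = x" using l by (metis in_set_conv_nth)
      then show "\<exists>i<m. v ! i = x" using l u by (intro exI[of _ i]) (simp add: v_def nth_append)
    qed
    then obtain h where h: "\<forall>x\<in>set u. h x < m \<and> v ! h x = x" by metis
    then have "map h u \<in> words m n" "map ((!) v) (map h u) = u"
      using u by (auto simp: words_def intro: map_idI)
    ultimately show "u \<in> (\<lambda>(v, f). map ((!) v) f) ` (words k m \<times> words m n)"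
      by (intro image_eqI[of _ _ "(v, map h u)"]) auto
  qed
  then have "card {u \<in> words k n. card (set u) \<le> m}
      \<le> card ((\<lambda>(v, f). map ((!) v) f) ` (words k m \<times> words m n))"
    by (intro card_mono finite_imageI finite_cartesian_product finite_words)
  also have "\<dots> \<le> card (words k m \<times> words m n)"
    by (intro card_image_le finite_cartesian_product finite_words)
  finally show ?thesis by (simp add: card_cartesian_product card_words mult.commute)
qed

text \<open>The error \<open>?e u\<close> of the two-term count vanishes unless \<open>u\<close> has
  at most \<open>n - 2\<close> letters. On those few words it lies between
  \<open>- card (Av n)\<close> and \<open>card (swap_triples n)\<close>.\<close>

lemma card_RSS_estimate:
  assumes k: "k \<ge> 1" and n: "n \<ge> 2"
  shows "\<bar>real (card (RSS k n)) -
      (real (card (Av n)) * real k ^ n - real (card (swap_triples n)) * real k ^ (n - 1))\<bar>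
    \<le> (real (card (Av n)) + real (card (swap_triples n))) * real ((n - 2) ^ n) * real k ^ (n - 2)"
proof -
  let ?r = "\<lambda>u. card ((\<lambda>p. map ((!) u) p) ` Av n)"
  let ?e = "\<lambda>u. real (?r u) + real (card (coincidences n u)) - real (card (Av n))"
  let ?K = "real (card (Av n)) + real (card (swap_triples n))"
  have e: "\<bar>?e u\<bar> \<le> (if card (set u) \<le> n - 2 then ?K else 0)" if "u \<in> words k n" for u
  proof (cases "card (set u) \<le> n - 2")
    case True
    have "?r u \<le> card (Av n)" by (rule card_image_le[OF finite_Av])
    moreover have "card (coincidences n u) \<le> card (swap_triples n)"
      by (rule card_mono[OF finite_swap_triples]) (auto simp: coincidences_def)
    ultimately show ?thesis using True by simp
  next
    case False
    then have "?r u + card (coincidences n u) = card (Av n)"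
      using that n by (intro card_image_few_coincidences) (auto simp: words_def)
    then show ?thesis using False by simp
  qed
  have "real (card (RSS k n)) -
      (real (card (Av n)) * real k ^ n - real (card (swap_triples n)) * real k ^ (n - 1)) =
      real (\<Sum>u\<in>words k n. ?r u) + real (\<Sum>u\<in>words k n. card (coincidences n u))
        - real (card (Av n)) * real (card (words k n))"
    unfolding sum_card_coincidences card_RSS card_words by simp
  also have "\<dots> = (\<Sum>u\<in>words k n. ?e u)"
    by (simp add: sum.distrib sum_subtractf)
  finally have "\<bar>real (card (RSS k n)) -
      (real (card (Av n)) * real k ^ n - real (card (swap_triples n)) * real k ^ (n - 1))\<bar> \<le>
      (\<Sum>u\<in>words k n. \<bar>?e u\<bar>)"
    using sum_abs[of ?e] by simp
  also have "\<dots> \<le> (\<Sum>u\<in>words k n. if card (set u) \<le> n - 2 then ?K else 0)"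
    by (rule sum_mono[OF e])
  also have "\<dots> = ?K * real (card {u \<in> words k n. card (set u) \<le> n - 2})"
    by (simp add: sum.inter_filter[OF finite_words, symmetric])
  also have "\<dots> \<le> ?K * real ((n - 2) ^ n * k ^ (n - 2))"
    by (intro mult_left_mono of_nat_mono card_words_few_letters[OF k]) simp
  finally show ?thesis by (simp add: mult.assoc)
qed

subsection \<open>The coefficients\<close>

lemma swaps_eq: "p \<in> Av n \<Longrightarrow> swaps p = above_pairs p \<union> greatest_pairs p"
  using avoids123_swap_iff[of p] by (auto simp: swaps_def above_pairs_def greatest_pairs_def Av_def)

text \<open>Inclusion and exclusion, with the two large families equinumerous by duality. The
  coefficients arise as \<open>2 * (-3) - 2 = -8\<close> and
  \<open>2 * (l + 2) + 3 = 2 * l + 7\<close>.\<close>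

lemma card_swap_triples:
  "int (card (swap_triples (l + 2))) =
    2 * int (catalan (l + 3)) - 8 * int (catalan (l + 2)) + (2 * int l + 7) * int (catalan (l + 1))"
proof -
  let ?n = "Suc (Suc l)"
  have fin: "finite (greatest_pairs p)" for p
    by (rule finite_subset[of _ "set p \<times> set p"]) (auto simp: greatest_pairs_def dest: before_set)
  have "above_pairs p \<inter> greatest_pairs p = both_pairs p" for p
    by (auto simp: above_pairs_def both_pairs_def greatest_pairs_def)
  then have "card (swaps p) + card (both_pairs p) = card (above_pairs p) + card (greatest_pairs p)" if "p \<in> Av ?n" for p
    using card_Un_Int[OF finite_above_pairs fin, of p p] swaps_eq[OF that] by simp
  then have "(\<Sum>p\<in>Av ?n. card (swaps p)) + (\<Sum>p\<in>Av ?n. card (both_pairs p)) =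
      (\<Sum>p\<in>Av ?n. card (above_pairs p)) + (\<Sum>p\<in>Av ?n. card (greatest_pairs p))"
    by (simp flip: sum.distrib)
  moreover have "card (swap_triples ?n) = (\<Sum>p\<in>Av ?n. card (swaps p))"
    by (simp add: swap_triples_def finite_Av finite_swaps)
  ultimately have "int (card (swap_triples ?n)) =
      2 * int (\<Sum>p\<in>Av ?n. card (above_pairs p)) - int (\<Sum>p\<in>Av ?n. card (both_pairs p))"
    unfolding sum_card_greatest_pairs by linarith
  then show ?thesis
    unfolding sum_card_above_pairs sum_card_both_pairs
    by (simp add: algebra_simps numeral_3_eq_3 del: ballot.simps)
qed

lemma catalan_Suc: "(n + 2) * catalan (Suc n) = 2 * (2 * n + 1) * catalan n"
proof -
  have "Suc n * ((2 * n + 2) choose Suc n) = (2 * n + 2) * ((2 * n + 1) choose n)"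
    using binomial_absorption[of n "2 * n + 2"] by simp
  also have "\<dots> = 2 * ((n + 1) * ((2 * n + 1) choose n))" by simp
  also have "(n + 1) * ((2 * n + 1) choose n) = (2 * n + 1) * ((2 * n) choose n)"
    using binomial_absorb_comp[of "2 * n + 1" n] by simp
  finally have "Suc n * (Suc (Suc n) * catalan (Suc n)) = 2 * ((2 * n + 1) * (Suc n * catalan n))"
    using catalan_closed_form[of n] catalan_closed_form[of "Suc n"] by (simp del: ballot.simps)
  then have "Suc n * ((n + 2) * catalan (Suc n)) = Suc n * (2 * (2 * n + 1) * catalan n)"
    by (simp only: ac_simps add_2_eq_Suc')
  then show ?thesis by (simp only: mult_cancel1) simp
qed

text \<open>Applying \<open>catalan_Suc\<close> twice expresses the Catalan numbers \<open>e\<close>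
  at \<open>n + 1\<close> and \<open>d\<close> at \<open>n\<close> through \<open>c\<close> at
  \<open>n - 1\<close>, and the binomial equals \<open>n * c\<close>.\<close>

lemma card_swap_triples_closed_form:
  assumes "n \<ge> 2"
  shows "real (card (swap_triples n)) =
    (2 * real n ^ 3 + 9 * real n ^ 2 - 35 * real n + 30) / (real n ^ 3 + 3 * real n ^ 2 + 2 * real n)
      * real ((2 * n - 2) choose (n - 1))"
proof -
  obtain l where l: "n = l + 2" using assms by (metis add.commute le_Suc_ex)
  define c where "c = real (catalan (l + 1))"
  define d where "d = real (catalan (l + 2))"
  define e where "e = real (catalan (l + 3))"
  have t: "real (card (swap_triples n)) = 2 * e - 8 * d + (2 * real n + 3) * c"
    using arg_cong[OF card_swap_triples[of l], of real_of_int] unfolding l c_def d_def e_def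
    by (simp add: algebra_simps del: ballot.simps)
  have "l + 1 + 2 = l + 3" "Suc (l + 1) = l + 2" "2 * (l + 1) + 1 = 2 * l + 3" by simp_all
  then have "real ((l + 3) * catalan (l + 2)) = real (2 * (2 * l + 3) * catalan (l + 1))"
    using catalan_Suc[of "l + 1"] by (simp only:)
  then have "(real l + 3) * d = 2 * (2 * real l + 3) * c"
    unfolding d_def c_def by (simp only: of_nat_mult of_nat_add of_nat_numeral)
  moreover have "real l = real n - 2" unfolding l by simp
  ultimately have d: "(real n + 1) * d = 2 * (2 * real n - 1) * c"
    by (simp add: add.commute)
  have "l + 2 + 2 = n + 2" "Suc (l + 2) = l + 3" "2 * (l + 2) + 1 = 2 * n + 1" unfolding l by simp_all
  then have "real ((n + 2) * catalan (l + 3)) = real (2 * (2 * n + 1) * catalan (l + 2))"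
    using catalan_Suc[of "l + 2"] by (simp only:)
  then have e: "(real n + 2) * e = 2 * (2 * real n + 1) * d"
    unfolding d_def e_def by (simp only: of_nat_mult of_nat_add of_nat_numeral of_nat_1)
  have "2 * n - 2 = 2 * (l + 1)" "n - 1 = l + 1" "l + 1 + 1 = n" unfolding l by simp_all
  then have "(2 * n - 2) choose (n - 1) = n * catalan (l + 1)"
    using catalan_closed_form[of "l + 1"] by (simp only:)
  then have b: "real ((2 * n - 2) choose (n - 1)) = real n * c"
    unfolding c_def by (simp only: of_nat_mult)
  have n: "real n > 0" using assms by simp
  have den: "real n ^ 3 + 3 * real n ^ 2 + 2 * real n = real n * ((real n + 1) * (real n + 2))"
    by (simp add: power2_eq_square power3_eq_cube algebra_simps)
  \<comment> \<open>Clearing the denominators \<open>n + 1\<close> and \<open>n + 2\<close> of the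
    two ratios; first \<open>e\<close> is eliminated, then \<open>d\<close>.\<close>
  have poly: "(2 * e - 8 * d + (2 * real n + 3) * c) * ((real n + 1) * (real n + 2)) =
      (2 * real n ^ 3 + 9 * real n ^ 2 - 35 * real n + 30) * c"
  proof -
    have "(2 * e - 8 * d + (2 * real n + 3) * c) * ((real n + 1) * (real n + 2)) =
        2 * (real n + 1) * ((real n + 2) * e) - 8 * (real n + 2) * ((real n + 1) * d)
        + (2 * real n + 3) * (real n + 1) * (real n + 2) * c" by (simp add: algebra_simps)
    also have "\<dots> = 4 * (2 * real n + 1) * ((real n + 1) * d) - 8 * (real n + 2) * ((real n + 1) * d)
        + (2 * real n + 3) * (real n + 1) * (real n + 2) * c"
      unfolding e by (simp add: algebra_simps)
    also have "\<dots> = (2 * real n ^ 3 + 9 * real n ^ 2 - 35 * real n + 30) * c"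
      unfolding d by (simp add: algebra_simps power2_eq_square power3_eq_cube)
    finally show ?thesis .
  qed
  have quot: "T = P / (N * M) * (N * c)" if "T * M = P * c" "N \<noteq> 0" "M \<noteq> 0" for T P M N :: real
    using that by (simp add: field_simps)
  show ?thesis unfolding t b den by (rule quot[OF poly]) (use n in auto)
qed

theorem theorem1p2:
  shows "(\<forall>k::nat. k \<ge> 2 \<longrightarrow> card (RSS k 1) = k) \<and>
    (\<forall>n::nat. n \<ge> 2 \<longrightarrow>
      (\<exists>K::real. K > 0 \<and>
        (\<forall>k::nat. k \<ge> 2 \<longrightarrow>
          \<bar>real (card (RSS k n)) -
             (1 / (real n + 1) * real ((2 * n) choose n) * real k ^ n
              - (2 * real n ^ 3 + 9 * real n ^ 2 - 35 * real n + 30)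
                  / (real n ^ 3 + 3 * real n ^ 2 + 2 * real n)
                * real ((2 * n - 2) choose (n - 1)) * real k ^ (n - 1))\<bar>
          \<le> K * real k ^ (n - 2))))"
proof (intro conjI allI impI)
  fix k :: nat
  have "Av 1 = {[0]}"
  proof -
    have "p = [0]" if "p \<in> Av 1" for p
      using Av_length[OF that] that by (cases p) (auto simp: Av_def)
    moreover have "[0] \<in> Av 1" by (auto simp: Av_def avoids123_def)
    ultimately show ?thesis by blast
  qed
  then show "card (RSS k 1) = k"
    using card_words[of k 1] by (simp add: card_RSS)
next
  fix n :: nat
  assume n: "n \<ge> 2"
  \<comment> \<open>The added 1 keeps \<open>K\<close> positive when \<open>n = 2\<close>, where
    \<open>(n - 2) ^ n\<close> is 0.\<close>
  define K where
    "K = (real (card (Av n)) + real (card (swap_triples n))) * real ((n - 2) ^ n) + 1"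
  have lead: "real (card (Av n)) = 1 / (real n + 1) * real ((2 * n) choose n)"
    using arg_cong[OF catalan_closed_form[of n], of real] by (simp add: card_Av field_simps)
  show "\<exists>K::real. K > 0 \<and>
        (\<forall>k::nat. k \<ge> 2 \<longrightarrow>
          \<bar>real (card (RSS k n)) -
             (1 / (real n + 1) * real ((2 * n) choose n) * real k ^ n
              - (2 * real n ^ 3 + 9 * real n ^ 2 - 35 * real n + 30)
                  / (real n ^ 3 + 3 * real n ^ 2 + 2 * real n)
                * real ((2 * n - 2) choose (n - 1)) * real k ^ (n - 1))\<bar>
          \<le> K * real k ^ (n - 2))"
  proof (intro exI[of _ K] conjI allI impI)
    show "K > 0" by (simp add: K_def add_nonneg_pos)
    fix k :: nat
    assume "k \<ge> 2"
    then have "\<bar>real (card (RSS k n)) -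
        (real (card (Av n)) * real k ^ n - real (card (swap_triples n)) * real k ^ (n - 1))\<bar>
        \<le> (K - 1) * real k ^ (n - 2)"
      using card_RSS_estimate[of k n] n by (simp add: K_def)
    also have "\<dots> \<le> K * real k ^ (n - 2)" by (intro mult_right_mono) simp_all
    finally show "\<bar>real (card (RSS k n)) -
             (1 / (real n + 1) * real ((2 * n) choose n) * real k ^ n
              - (2 * real n ^ 3 + 9 * real n ^ 2 - 35 * real n + 30)
                  / (real n ^ 3 + 3 * real n ^ 2 + 2 * real n)
                * real ((2 * n - 2) choose (n - 1)) * real k ^ (n - 1))\<bar>
          \<le> K * real k ^ (n - 2)"
      unfolding lead card_swap_triples_closed_form[OF n] .
  qed
qed

end
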